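(* Let $R$ be a ring and let $G$ be a finitely generated group. If $\varphi\in S(G)$, then $\mathcal{D}(RG\subset\widehat{RG}^{\varphi})=\mathcal{R}(RG\subset\widehat{RG}^{\varphi})$.
   Context: Rings are associative and unital. $S(G)=\mathrm{Hom}(G;\mathbb{R})\smallsetminus\{0\}$. The Novikov–Sikorav ring $\widehat{RG}^{\varphi}$ is the ring of formal sums $\sum_{g\in G}n_gg$, $n_g\in R$, such that $\{g:n_g\ne0\text{ and }\varphi(g)<s\}$ is finite for every $s\in\mathbb{R}$; it contains $RG$. Let $S$ be a subring of a ring $A$. $S$ is division closed in $A$ if every element of $S$ invertible over $A$ is invertible over $S$; $S$ is rationally closed in $A$ if every finite square matrix over $S$ invertible over $A$ is invertible over $S$. The division closure $\mathcal{D}(S\subset A)$ (respectively rational closure $\mathcal{R}(S\subset A)$) is the smallest division-closed (respectively rationally closed) subring of $A$ containing $S$. *)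

theory Defs
  imports Complex_Main "HOL-Algebra.Subrings" "HOL-Algebra.Generated_Groups"
begin

section \<open>Finitely generated groups and characters\<close>

definition finitely_generated :: "('g, 'n) monoid_scheme \<Rightarrow> bool" where
  "finitely_generated G \<longleftrightarrow>
     (\<exists>B. finite B \<and> B \<subseteq> carrier G \<and> generate G B = carrier G)"

definition real_group :: "real monoid" where
  "real_group = \<lparr>carrier = UNIV, monoid.mult = (+), one = 0\<rparr>"

text \<open>The set \<open>S(G)\<close> of nonzero homomorphisms to the additive group of the reals.  As usual for
  \<^const>\<open>hom\<close>, the values of a homomorphism outside the carrier of \<open>G\<close> carry no meaning.\<close>

definition nonzero_characters :: "('g, 'n) monoid_scheme \<Rightarrow> ('g \<Rightarrow> real) set" where
  "nonzero_characters G = {\<phi> \<in> hom G real_group. \<exists>g\<in>carrier G. \<phi> g \<noteq> 0}"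


section \<open>Rings of formal sums\<close>

text \<open>A formal sum \<open>\<Sum>g. n\<^sub>g g\<close> is its coefficient function, taken to be extensional so that
  equality of formal sums is equality of functions.\<close>

definition formal_sums ::
    "('r, 'm) ring_scheme \<Rightarrow> ('g, 'n) monoid_scheme \<Rightarrow> ('g \<Rightarrow> 'r) set" where
  "formal_sums R G = carrier G \<rightarrow>\<^sub>E carrier R"

text \<open>Only finitely many \<open>h\<close> contribute to the coefficient at \<open>g\<close> of a product of two elements
  of a Novikov-Sikorav ring.  Summing over the nonzero coefficients rather than over the whole
  group is essential, since \<^const>\<open>finsum\<close> over an infinite index set is zero.\<close>

definition convolution ::
    "('r, 'm) ring_scheme \<Rightarrow> ('g, 'n) monoid_scheme \<Rightarrow> ('g \<Rightarrow> 'r) \<Rightarrow> ('g \<Rightarrow> 'r) \<Rightarrow> ('g \<Rightarrow> 'r)"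
  where
  "convolution R G a b =
     (\<lambda>g\<in>carrier G.
        \<Oplus>\<^bsub>R\<^esub> h \<in> {h \<in> carrier G. a h \<noteq> \<zero>\<^bsub>R\<^esub> \<and> b (inv\<^bsub>G\<^esub> h \<otimes>\<^bsub>G\<^esub> g) \<noteq> \<zero>\<^bsub>R\<^esub>}.
          a h \<otimes>\<^bsub>R\<^esub> b (inv\<^bsub>G\<^esub> h \<otimes>\<^bsub>G\<^esub> g))"

definition formal_sum_ring ::
    "('r, 'm) ring_scheme \<Rightarrow> ('g, 'n) monoid_scheme \<Rightarrow> ('g \<Rightarrow> 'r) set \<Rightarrow> ('g \<Rightarrow> 'r) ring" where
  "formal_sum_ring R G F =
     \<lparr>carrier = F,
      monoid.mult = convolution R G,
      one = (\<lambda>g\<in>carrier G. if g = \<one>\<^bsub>G\<^esub> then \<one>\<^bsub>R\<^esub> else \<zero>\<^bsub>R\<^esub>),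
      zero = (\<lambda>g\<in>carrier G. \<zero>\<^bsub>R\<^esub>),
      add = (\<lambda>a b. \<lambda>g\<in>carrier G. a g \<oplus>\<^bsub>R\<^esub> b g)\<rparr>"

definition group_ring ::
    "('r, 'm) ring_scheme \<Rightarrow> ('g, 'n) monoid_scheme \<Rightarrow> ('g \<Rightarrow> 'r) ring" where
  "group_ring R G =
     formal_sum_ring R G {a \<in> formal_sums R G. finite {g \<in> carrier G. a g \<noteq> \<zero>\<^bsub>R\<^esub>}}"

definition novikov_ring ::
    "('r, 'm) ring_scheme \<Rightarrow> ('g, 'n) monoid_scheme \<Rightarrow> ('g \<Rightarrow> real) \<Rightarrow> ('g \<Rightarrow> 'r) ring" where
  "novikov_ring R G \<phi> =
     formal_sum_ring R G
       {a \<in> formal_sums R G.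
          \<forall>s::real. finite {g \<in> carrier G. a g \<noteq> \<zero>\<^bsub>R\<^esub> \<and> \<phi> g < s}}"


section \<open>Division closure and rational closure\<close>

definition division_closed :: "'a set \<Rightarrow> ('a, 'm) ring_scheme \<Rightarrow> bool" where
  "division_closed S A \<longleftrightarrow> (\<forall>x\<in>S. x \<in> Units A \<longrightarrow> x \<in> Units (A\<lparr>carrier := S\<rparr>))"

text \<open>The multiplicative monoid of \<open>n \<times> n\<close> matrices, indexed from \<open>0\<close>; its \<^const>\<open>Units\<close> are the
  matrices with a two-sided inverse.\<close>

definition square_matrices :: "('a, 'm) ring_scheme \<Rightarrow> nat \<Rightarrow> (nat \<times> nat \<Rightarrow> 'a) monoid" where
  "square_matrices A n =
     \<lparr>carrier = ({..<n} \<times> {..<n}) \<rightarrow>\<^sub>E carrier A,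
      monoid.mult = (\<lambda>M N. \<lambda>(i, k)\<in>{..<n} \<times> {..<n}.
                       \<Oplus>\<^bsub>A\<^esub> j \<in> {..<n}. M (i, j) \<otimes>\<^bsub>A\<^esub> N (j, k)),
      one = (\<lambda>(i, k)\<in>{..<n} \<times> {..<n}. if i = k then \<one>\<^bsub>A\<^esub> else \<zero>\<^bsub>A\<^esub>)\<rparr>"

definition rationally_closed :: "'a set \<Rightarrow> ('a, 'm) ring_scheme \<Rightarrow> bool" where
  "rationally_closed S A \<longleftrightarrow>
     (\<forall>n. \<forall>M\<in>carrier (square_matrices (A\<lparr>carrier := S\<rparr>) n).
        M \<in> Units (square_matrices A n) \<longrightarrow> M \<in> Units (square_matrices (A\<lparr>carrier := S\<rparr>) n))"

text \<open>By uniqueness of inverses both properties are stable under intersections of subrings, so the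
  intersections below are the smallest such subrings.\<close>

definition division_closure :: "'a set \<Rightarrow> ('a, 'm) ring_scheme \<Rightarrow> 'a set" where
  "division_closure S A = \<Inter> {T. subring T A \<and> division_closed T A \<and> S \<subseteq> T}"

definition rational_closure :: "'a set \<Rightarrow> ('a, 'm) ring_scheme \<Rightarrow> 'a set" where
  "rational_closure S A = \<Inter> {T. subring T A \<and> rationally_closed T A \<and> S \<subseteq> T}"

end

theory Submission
  imports Defs
begin

text \<open>The two closures agree because the two closedness conditions select the same subrings: a
  subring \<open>T\<close> of the Novikov-Sikorav ring \<open>A\<close> that contains the group ring is division closed if and
  only if it is rationally closed (\<open>novikov_rationally_closed_iff\<close>).  The interesting direction is
  from elements to matrices.

  Let \<open>M\<close> be a square matrix over \<open>T\<close> with inverse \<open>N\<close> over \<open>A\<close>.  Let \<open>J\<close> be the set of elements of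
  \<open>A\<close> supported where \<open>\<phi>\<close> is positive.  Cutting off the entries of \<open>N\<close> at a large value of \<open>\<phi>\<close> gives a
  matrix \<open>P\<close> over the group ring, hence over \<open>T\<close>, such that \<open>M P = I + M (P - N)\<close> is congruent to the
  identity modulo \<open>J\<close> (\<open>group_ring_approximation\<close>).  By the geometric series every element of \<open>1 + J\<close> is
  invertible in \<open>A\<close>, with inverse in \<open>1 + J\<close> (\<open>positive_part_quasi_inverse\<close>), and for elements of \<open>T\<close>
  the inverse is in \<open>T\<close> by division closedness.  So the diagonal entries of \<open>M P\<close> are invertible over
  \<open>T\<close>, and stay of the form \<open>1 + j\<close> during Gaussian elimination: \<open>M P\<close> has a right inverse \<open>Q\<close>
  over \<open>T\<close> (\<open>linear_system_solvable\<close>).  From \<open>M P Q = I\<close> it follows that \<open>N = P Q\<close> is a matrix over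
  \<open>T\<close> (\<open>division_closed_imp_rationally_closed\<close>).

  The converse is the case of \<open>1 \<times> 1\<close> matrices (\<open>rationally_closed_imp_division_closed\<close>).  The remaining
  work is to show that the formal sums form a ring, so that these arguments apply.\<close>

section \<open>Finite sums in a ring\<close>

lemma (in ring) subring_finsum:
  assumes "subring T R" "finite I" "\<And>i. i \<in> I \<Longrightarrow> f i \<in> T"
  shows "finsum R f I \<in> T" and "finsum (R\<lparr>carrier := T\<rparr>) f I = finsum R f I"
proof -
  interpret S: ring "R\<lparr>carrier := T\<rparr>" by (rule subring_is_ring[OF assms(1)])
  note T = subringE[OF assms(1)]
  have "finsum (R\<lparr>carrier := T\<rparr>) f I = finsum R f I \<and> finsum R f I \<in> T"
    using assms(2,3)
  proof (induction I rule: finite_induct)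
    case empty
    then show ?case using T S.finsum_empty by simp
  next
    case (insert i I)
    then have f: "f i \<in> T" "\<And>j. j \<in> I \<Longrightarrow> f j \<in> T" by auto
    then have fc: "f i \<in> carrier R" "f \<in> I \<rightarrow> carrier R" using T(1) by auto
    have "finsum (R\<lparr>carrier := T\<rparr>) f (insert i I) = f i \<oplus> finsum (R\<lparr>carrier := T\<rparr>) f I"
      using S.finsum_insert[of I i f] insert.hyps f by auto
    moreover have "finsum R f (insert i I) = f i \<oplus> finsum R f I"
      using finsum_insert[of I i f] insert.hyps fc by auto
    ultimately show ?case using insert.IH f T(7) by auto
  qed
  then show "finsum R f I \<in> T" "finsum (R\<lparr>carrier := T\<rparr>) f I = finsum R f I" by auto
qed

lemma (in ring) finsum_lessThan_Suc:
  assumes "\<And>j. j < Suc n \<Longrightarrow> f j \<in> carrier R"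
  shows "finsum R f {..<Suc n} = finsum R f {..<n} \<oplus> f n"
proof -
  have "finsum R f (insert n {..<n}) = f n \<oplus> finsum R f {..<n}"
    using assms by (intro finsum_insert) auto
  also have "\<dots> = finsum R f {..<n} \<oplus> f n"
    using assms by (intro a_comm finsum_closed) auto
  finally show ?thesis by (simp add: lessThan_Suc)
qed

lemma (in ring) finsum_swap:
  assumes "finite I" "finite L" "\<And>i j. i \<in> I \<Longrightarrow> j \<in> L \<Longrightarrow> f i j \<in> carrier R"
  shows "(\<Oplus>i\<in>I. \<Oplus>j\<in>L. f i j) = (\<Oplus>j\<in>L. \<Oplus>i\<in>I. f i j)"
  using assms(1,3)
proof (induction I rule: finite_induct)
  case empty
  then show ?case by simp
next
  case (insert i I)
  then have f: "\<And>j. j \<in> L \<Longrightarrow> f i j \<in> carrier R"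
    "\<And>i' j. i' \<in> I \<Longrightarrow> j \<in> L \<Longrightarrow> f i' j \<in> carrier R" by auto
  have "(\<Oplus>i\<in>insert i I. \<Oplus>j\<in>L. f i j) = (\<Oplus>j\<in>L. f i j) \<oplus> (\<Oplus>i\<in>I. \<Oplus>j\<in>L. f i j)"
    using insert.hyps f by (intro finsum_insert) (auto intro!: finsum_closed)
  also have "\<dots> = (\<Oplus>j\<in>L. f i j) \<oplus> (\<Oplus>j\<in>L. \<Oplus>i\<in>I. f i j)"
    using insert.IH f by simp
  also have "\<dots> = (\<Oplus>j\<in>L. f i j \<oplus> (\<Oplus>i\<in>I. f i j))"
    using f by (intro finsum_addf[symmetric]) (auto intro!: finsum_closed)
  also have "\<dots> = (\<Oplus>j\<in>L. \<Oplus>i\<in>insert i I. f i j)"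
    using insert.hyps f by (intro finsum_cong' finsum_insert[symmetric]) (auto intro!: finsum_closed)
  finally show ?case .
qed

lemma (in ring) geometric_sum:
  assumes z: "z \<in> carrier R"
  shows "(\<one> \<ominus> z) \<otimes> (\<Oplus>k\<in>{..<n}. z [^] k) = \<one> \<ominus> z [^] (n::nat)"
    and "(\<Oplus>k\<in>{..<n}. z [^] k) \<otimes> (\<one> \<ominus> z) = \<one> \<ominus> z [^] (n::nat)"
proof -
  have pow: "z [^] k \<in> carrier R" for k :: nat using z by simp
  have comm: "z \<otimes> z [^] k = z [^] k \<otimes> z" for k :: nat using z by (metis nat_pow_Suc nat_pow_Suc2)
  have telescope: "\<one> \<ominus> a \<oplus> (a \<ominus> b) = \<one> \<ominus> b" if "a \<in> carrier R" "b \<in> carrier R" for a b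
    using that by (simp add: minus_eq a_assoc r_neg2 r_neg1)
  have "(\<one> \<ominus> z) \<otimes> (\<Oplus>k\<in>{..<n}. z [^] k) = \<one> \<ominus> z [^] n \<and>
    (\<Oplus>k\<in>{..<n}. z [^] k) \<otimes> (\<one> \<ominus> z) = \<one> \<ominus> z [^] n"
  proof (induction n)
    case 0
    then show ?case using z by (simp add: minus_eq r_neg)
  next
    case (Suc n)
    define s where "s = (\<Oplus>k\<in>{..<n}. z [^] k)"
    have s: "s \<in> carrier R" unfolding s_def using pow by (intro finsum_closed) auto
    have sum: "(\<Oplus>k\<in>{..<Suc n}. z [^] k) = s \<oplus> z [^] n"
      unfolding s_def using pow by (rule finsum_lessThan_Suc)
    have "(\<one> \<ominus> z) \<otimes> (s \<oplus> z [^] n) = \<one> \<ominus> z [^] n \<oplus> (z [^] n \<ominus> z [^] Suc n)"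
      using Suc.IH s z pow[of n] comm[of n]
      by (simp add: s_def[symmetric] r_distr) (simp add: minus_eq l_distr l_minus)
    moreover have "(s \<oplus> z [^] n) \<otimes> (\<one> \<ominus> z) = \<one> \<ominus> z [^] n \<oplus> (z [^] n \<ominus> z [^] Suc n)"
      using Suc.IH s z pow[of n]
      by (simp add: s_def[symmetric] l_distr) (simp add: minus_eq r_distr r_minus)
    ultimately show ?case unfolding sum using telescope[OF pow[of n] pow[of "Suc n"]] by simp
  qed
  then show "(\<one> \<ominus> z) \<otimes> (\<Oplus>k\<in>{..<n}. z [^] k) = \<one> \<ominus> z [^] n"
    "(\<Oplus>k\<in>{..<n}. z [^] k) \<otimes> (\<one> \<ominus> z) = \<one> \<ominus> z [^] n" by auto
qed

lemma (in ring) add_minus_cancel: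
  assumes "x \<in> carrier R" "y \<in> carrier R"
  shows "x \<oplus> (y \<ominus> x) = y"
  using assms by (simp add: minus_eq a_comm[of y "\<ominus> x"] r_neg2)

section \<open>Gaussian elimination over a radical subring\<close>

text \<open>The set \<open>K\<close> is a radical subring without unit: \<open>1 + x\<close> is invertible with inverse in
  \<open>1 + K\<close> for each of its elements.  Then matrices in \<open>I + M\<^sub>n(K)\<close> are right invertible, because
  Gaussian elimination never runs out of pivots: eliminating the last unknown with the pivot
  \<open>1 + p\<close>, whose right inverse is \<open>q \<in> 1 + K\<close>, changes the entry at \<open>(i, j)\<close> by
  \<open>M\<^sub>i\<^sub>n q M\<^sub>n\<^sub>j \<in> K\<close>, so the reduced matrix has the same form.  Phrasing the result as solvability for
  every right-hand side keeps the induction free of block matrices.\<close>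

lemma (in ring) linear_system_solvable:
  fixes n :: nat
  assumes T: "subring T R"
    and K: "K \<subseteq> T"
      "\<And>x y. x \<in> K \<Longrightarrow> y \<in> K \<Longrightarrow> x \<ominus> y \<in> K"
      "\<And>x y. x \<in> K \<Longrightarrow> y \<in> K \<Longrightarrow> x \<otimes> y \<in> K"
      "\<And>x. x \<in> K \<Longrightarrow> \<exists>y\<in>K. (\<one> \<oplus> x) \<otimes> (\<one> \<oplus> y) = \<one>"
    and M: "\<And>i j. i < n \<Longrightarrow> j < n \<Longrightarrow> \<exists>x\<in>K. M i j = (if i = j then \<one> else \<zero>) \<oplus> x"
    and b: "\<And>i. i < n \<Longrightarrow> b i \<in> T"
  shows "\<exists>x. (\<forall>j<n. x j \<in> T) \<and> (\<forall>i<n. (\<Oplus>j\<in>{..<n}. M i j \<otimes> x j) = b i)"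
  using M b
proof (induction n arbitrary: M b)
  case 0
  then show ?case by simp
next
  case (Suc n)
  note TE = subringE[OF T]
  have K0: "x \<in> carrier R" if "x \<in> K" for x using that K(1) TE(1) by blast
  have MT: "M i j \<in> T" if ij: "i < Suc n" "j < Suc n" for i j
  proof -
    obtain x where "x \<in> K" "M i j = (if i = j then \<one> else \<zero>) \<oplus> x"
      using Suc.prems(1)[OF ij] by blast
    then show ?thesis using K(1) TE(2,3,7) by auto
  qed
  then have MR: "M i j \<in> carrier R" if "i < Suc n" "j < Suc n" for i j
    using that TE(1) by blast
  have offdiag: "M i j \<in> K" if "i < Suc n" "j < Suc n" "i \<noteq> j" for i j
    using Suc.prems(1)[OF that(1,2)] that(3) K0 by auto
  obtain p where p: "p \<in> K" "M n n = \<one> \<oplus> p"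
    using Suc.prems(1)[of n n] by auto
  obtain q' where q': "q' \<in> K" "(\<one> \<oplus> p) \<otimes> (\<one> \<oplus> q') = \<one>"
    using K(4)[OF p(1)] by blast
  define q where "q = \<one> \<oplus> q'"
  have q: "M n n \<otimes> q = \<one>" "q \<in> T" "q \<in> carrier R"
    using p q' K(1) TE(1,3,7) unfolding q_def by auto
  define M' where "M' i j = M i j \<ominus> M i n \<otimes> q \<otimes> M n j" for i j
  define b' where "b' i = b i \<ominus> M i n \<otimes> q \<otimes> b n" for i
  \<comment> \<open>Closure of \<open>K\<close> under sums is only available through differences.\<close>
  have K1: "M i n \<otimes> q \<in> K" if "i < n" for i
  proof -
    have a: "M i n \<in> K" using offdiag that by simp
    then have "M i n \<otimes> q' \<in> K" using q'(1) K(3) by blast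
    moreover have "\<ominus> (M i n \<otimes> q') \<in> K"
      using K(2)[OF K(2)[OF calculation calculation] calculation] K0[OF calculation]
      by (simp add: minus_eq r_neg)
    then have "M i n \<ominus> \<ominus> (M i n \<otimes> q') \<in> K" using a K(2) by blast
    moreover have "M i n \<otimes> q = M i n \<ominus> \<ominus> (M i n \<otimes> q')"
      unfolding q_def using K0 a q'(1) by (simp add: r_distr minus_eq)
    ultimately show ?thesis by simp
  qed
  have M': "\<exists>x\<in>K. M' i j = (if i = j then \<one> else \<zero>) \<oplus> x" if ij: "i < n" "j < n" for i j
  proof -
    obtain x where x: "x \<in> K" "M i j = (if i = j then \<one> else \<zero>) \<oplus> x"
      using Suc.prems(1)[of i j] ij by auto
    have y: "M i n \<otimes> q \<otimes> M n j \<in> K" using K1[OF ij(1)] offdiag[of n j] ij K(3) by auto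
    have "M' i j = (if i = j then \<one> else \<zero>) \<oplus> (x \<ominus> M i n \<otimes> q \<otimes> M n j)"
      unfolding M'_def x(2) using K0[OF x(1)] K0[OF y] by (simp add: minus_eq a_assoc)
    with x(1) y K(2) show ?thesis by blast
  qed
  have bR: "b i \<in> carrier R" if "i < Suc n" for i using Suc.prems(2)[OF that] TE(1) by blast
  have b': "b' i \<in> T" if "i < n" for i
    unfolding b'_def minus_eq using that Suc.prems(2) MT q(2) TE(5,6,7) by auto
  obtain x where x: "\<And>j. j < n \<Longrightarrow> x j \<in> T"
      and sol: "\<And>i. i < n \<Longrightarrow> (\<Oplus>j\<in>{..<n}. M' i j \<otimes> x j) = b' i"
    using Suc.IH[of M' b', OF M' b'] by blast
  have xR: "x j \<in> carrier R" if "j < n" for j using x[OF that] TE(1) by blast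
  define s where "s i = (\<Oplus>j\<in>{..<n}. M i j \<otimes> x j)" for i
  have s: "s i \<in> T" if "i < Suc n" for i
    unfolding s_def using that x MT TE(6) by (intro subring_finsum(1)[OF T]) auto
  then have sR: "s i \<in> carrier R" if "i < Suc n" for i using that TE(1) by blast
  \<comment> \<open>The last unknown, back-substituted from the last equation.\<close>
  define z where "z = q \<otimes> (b n \<ominus> s n)"
  define x' where "x' j = (if j = n then z else x j)" for j
  have z: "z \<in> T" unfolding z_def minus_eq using q(2) Suc.prems(2)[of n] s TE(5,6,7) by auto
  then have zR: "z \<in> carrier R" using TE(1) by blast
  have sum': "(\<Oplus>j\<in>{..<Suc n}. M i j \<otimes> x' j) = s i \<oplus> M i n \<otimes> z" if "i < Suc n" for i
  proof -
    have "(\<Oplus>j\<in>{..<Suc n}. M i j \<otimes> x' j) = (\<Oplus>j\<in>{..<n}. M i j \<otimes> x' j) \<oplus> M i n \<otimes> x' n"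
      by (intro finsum_lessThan_Suc) (use that MR xR zR in \<open>auto simp: x'_def\<close>)
    moreover have "(\<Oplus>j\<in>{..<n}. M i j \<otimes> x' j) = s i"
      unfolding s_def by (intro finsum_cong') (use that MR xR zR in \<open>auto simp: x'_def\<close>)
    ultimately show ?thesis by (simp add: x'_def)
  qed
  have "(\<Oplus>j\<in>{..<Suc n}. M i j \<otimes> x' j) = b i" if i: "i < Suc n" for i
  proof (cases "i = n")
    case True
    have "M n n \<otimes> z = (M n n \<otimes> q) \<otimes> (b n \<ominus> s n)"
      unfolding z_def using MR q(3) bR sR by (intro m_assoc[symmetric]) auto
    also have "\<dots> = b n \<ominus> s n" using q(1) bR sR by simp
    finally show ?thesis using sum'[of n] True bR[of n] sR[of n] by (simp add: add_minus_cancel)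
  next
    case False
    then have i': "i < n" using i by simp
    define c where "c = M i n \<otimes> q"
    have c: "c \<in> carrier R" unfolding c_def using MR q(3) i by simp
    have "b' i = (\<Oplus>j\<in>{..<n}. M' i j \<otimes> x j)" using sol[OF i'] by simp
    also have "\<dots> = (\<Oplus>j\<in>{..<n}. M i j \<otimes> x j \<oplus> \<ominus> c \<otimes> (M n j \<otimes> x j))"
      using MR[OF i] MR[of n] xR c
      by (intro finsum_cong') (auto simp: M'_def c_def[symmetric] minus_eq l_distr m_assoc l_minus)
    also have "\<dots> = s i \<oplus> (\<Oplus>j\<in>{..<n}. \<ominus> c \<otimes> (M n j \<otimes> x j))"
      unfolding s_def using MR[OF i] MR[of n] xR c by (intro finsum_addf) auto
    also have "(\<Oplus>j\<in>{..<n}. \<ominus> c \<otimes> (M n j \<otimes> x j)) = \<ominus> c \<otimes> s n"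
      unfolding s_def using MR[of n] xR c by (intro finsum_rdistr[symmetric]) auto
    finally have eq: "b' i = s i \<oplus> \<ominus> c \<otimes> s n" .
    have "M i n \<otimes> z = c \<otimes> (b n \<ominus> s n)"
      unfolding z_def c_def using MR[OF i, of n] q(3) bR[of n] sR[of n] by (simp add: m_assoc)
    also have "\<dots> = c \<otimes> b n \<ominus> c \<otimes> s n"
      using c bR[of n] sR[of n] by (simp add: minus_eq r_distr r_minus)
    finally have "s i \<oplus> M i n \<otimes> z = b' i \<oplus> c \<otimes> b n"
      unfolding eq using c bR[of n] sR[of n] sR[OF i] by (simp add: minus_eq a_ac l_minus)
    also have "\<dots> = b i" unfolding b'_def c_def[symmetric] using c bR[of n] bR[OF i]
      by (simp add: minus_eq a_ac r_neg)
    finally show ?thesis unfolding sum'[OF i] .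
  qed
  moreover have "x' j \<in> T" if "j < Suc n" for j using that x z by (auto simp: x'_def)
  ultimately show ?case by blast
qed

section \<open>Division-closed and rationally closed subrings\<close>

lemma square_matrices_simps:
  "carrier (square_matrices A n) = ({..<n} \<times> {..<n}) \<rightarrow>\<^sub>E carrier A"
  "one (square_matrices A n) = (\<lambda>(i, k)\<in>{..<n} \<times> {..<n}. if i = k then \<one>\<^bsub>A\<^esub> else \<zero>\<^bsub>A\<^esub>)"
  "monoid.mult (square_matrices A n) M N =
    (\<lambda>(i, k)\<in>{..<n} \<times> {..<n}. \<Oplus>\<^bsub>A\<^esub> j \<in> {..<n}. M (i, j) \<otimes>\<^bsub>A\<^esub> N (j, k))"
  by (simp_all add: square_matrices_def)

lemma (in ring) square_matrices_monoid: "monoid (square_matrices R n)"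
proof (rule monoidI)
  fix M N P
  assume M: "M \<in> carrier (square_matrices R n)" and N: "N \<in> carrier (square_matrices R n)"
  have MR: "M (i, j) \<in> carrier R" "N (i, j) \<in> carrier R" if "i < n" "j < n" for i j
    using M N that by (auto simp: square_matrices_simps PiE_mem)
  show "M \<otimes>\<^bsub>square_matrices R n\<^esub> N \<in> carrier (square_matrices R n)"
    using MR by (auto simp: square_matrices_simps intro!: finsum_closed)
  assume P: "P \<in> carrier (square_matrices R n)"
  have PR: "P (i, j) \<in> carrier R" if "i < n" "j < n" for i j
    using P that by (auto simp: square_matrices_simps PiE_mem)
  show "M \<otimes>\<^bsub>square_matrices R n\<^esub> N \<otimes>\<^bsub>square_matrices R n\<^esub> P
      = M \<otimes>\<^bsub>square_matrices R n\<^esub> (N \<otimes>\<^bsub>square_matrices R n\<^esub> P)"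
    unfolding square_matrices_simps
  proof (rule restrict_ext)
    fix x assume "x \<in> {..<n} \<times> {..<n}"
    then obtain i l where x: "x = (i, l)" and il: "i < n" "l < n" by auto
    have "(\<Oplus>k\<in>{..<n}. (\<lambda>(i, k)\<in>{..<n} \<times> {..<n}. \<Oplus>j\<in>{..<n}. M (i, j) \<otimes> N (j, k)) (i, k) \<otimes> P (k, l))
      = (\<Oplus>k\<in>{..<n}. \<Oplus>j\<in>{..<n}. M (i, j) \<otimes> N (j, k) \<otimes> P (k, l))"
      using il MR PR by (intro finsum_cong') (auto intro!: finsum_closed finsum_ldistr)
    also have "\<dots> = (\<Oplus>j\<in>{..<n}. \<Oplus>k\<in>{..<n}. M (i, j) \<otimes> N (j, k) \<otimes> P (k, l))"
      using il MR PR by (intro finsum_swap) auto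
    also have "\<dots> = (\<Oplus>j\<in>{..<n}. \<Oplus>k\<in>{..<n}. M (i, j) \<otimes> (N (j, k) \<otimes> P (k, l)))"
      using il MR PR by (intro finsum_cong' m_assoc) (auto intro!: finsum_closed)
    also have "\<dots> = (\<Oplus>j\<in>{..<n}. M (i, j) \<otimes> (\<Oplus>k\<in>{..<n}. N (j, k) \<otimes> P (k, l)))"
      using il MR PR by (intro finsum_cong' finsum_rdistr[symmetric]) (auto intro!: finsum_closed)
    also have "\<dots> = (\<Oplus>j\<in>{..<n}. M (i, j) \<otimes>
       (\<lambda>(i, k)\<in>{..<n} \<times> {..<n}. \<Oplus>j\<in>{..<n}. N (i, j) \<otimes> P (j, k)) (j, l))"
      using il MR PR by (intro finsum_cong') (auto intro!: finsum_closed)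
    finally show "(case x of (i, l) \<Rightarrow> \<Oplus>k\<in>{..<n}. (\<lambda>(i, k)\<in>{..<n} \<times> {..<n}. \<Oplus>j\<in>{..<n}. M (i, j) \<otimes> N (j, k)) (i, k) \<otimes> P (k, l))
      = (case x of (i, l) \<Rightarrow> \<Oplus>j\<in>{..<n}. M (i, j) \<otimes>
       (\<lambda>(i, k)\<in>{..<n} \<times> {..<n}. \<Oplus>j\<in>{..<n}. N (i, j) \<otimes> P (j, k)) (j, l))"
      by (simp add: x)
  qed
next
  show "\<one>\<^bsub>square_matrices R n\<^esub> \<in> carrier (square_matrices R n)"
    by (auto simp: square_matrices_simps)
next
  fix M assume M: "M \<in> carrier (square_matrices R n)"
  have MR: "M (i, j) \<in> carrier R" if "i < n" "j < n" for i j
    using M that by (auto simp: square_matrices_simps PiE_mem)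
  have ext: "M \<in> extensional ({..<n} \<times> {..<n})"
    using M by (auto simp: square_matrices_simps PiE_def)
  show "\<one>\<^bsub>square_matrices R n\<^esub> \<otimes>\<^bsub>square_matrices R n\<^esub> M = M"
  proof (rule extensionalityI[OF _ ext])
    fix x assume "x \<in> {..<n} \<times> {..<n}"
    then obtain i k where x: "x = (i, k)" "i < n" "k < n" by auto
    have "(\<Oplus>j\<in>{..<n}. (\<lambda>(i, k)\<in>{..<n} \<times> {..<n}. if i = k then \<one> else \<zero>) (i, j) \<otimes> M (j, k))
      = (\<Oplus>j\<in>{..<n}. if i = j then M (j, k) else \<zero>)"
      using x MR by (intro finsum_cong') auto
    also have "\<dots> = M (i, k)" using x MR by (intro finsum_singleton) auto
    finally show "(\<one>\<^bsub>square_matrices R n\<^esub> \<otimes>\<^bsub>square_matrices R n\<^esub> M) x = M x"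
      using x by (simp add: square_matrices_simps)
  qed (auto simp: square_matrices_simps)
  show "M \<otimes>\<^bsub>square_matrices R n\<^esub> \<one>\<^bsub>square_matrices R n\<^esub> = M"
  proof (rule extensionalityI[OF _ ext])
    fix x assume "x \<in> {..<n} \<times> {..<n}"
    then obtain i k where x: "x = (i, k)" "i < n" "k < n" by auto
    have "(\<Oplus>j\<in>{..<n}. M (i, j) \<otimes> (\<lambda>(i, k)\<in>{..<n} \<times> {..<n}. if i = k then \<one> else \<zero>) (j, k))
      = (\<Oplus>j\<in>{..<n}. if k = j then M (i, j) else \<zero>)"
      using x MR by (intro finsum_cong') auto
    also have "\<dots> = M (i, k)" using x MR by (intro finsum_singleton) auto
    finally show "(M \<otimes>\<^bsub>square_matrices R n\<^esub> \<one>\<^bsub>square_matrices R n\<^esub>) x = M x"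
      using x by (simp add: square_matrices_simps)
  qed (auto simp: square_matrices_simps)
qed

lemma (in ring) square_matrices_subring:
  assumes T: "subring T R"
  shows "carrier (square_matrices (R\<lparr>carrier := T\<rparr>) n) \<subseteq> carrier (square_matrices R n)"
    and "\<one>\<^bsub>square_matrices (R\<lparr>carrier := T\<rparr>) n\<^esub> = \<one>\<^bsub>square_matrices R n\<^esub>"
    and "\<lbrakk>M \<in> carrier (square_matrices (R\<lparr>carrier := T\<rparr>) n); N \<in> carrier (square_matrices (R\<lparr>carrier := T\<rparr>) n)\<rbrakk>
      \<Longrightarrow> M \<otimes>\<^bsub>square_matrices (R\<lparr>carrier := T\<rparr>) n\<^esub> N = M \<otimes>\<^bsub>square_matrices R n\<^esub> N"
proof -
  note TE = subringE[OF T]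
  show "carrier (square_matrices (R\<lparr>carrier := T\<rparr>) n) \<subseteq> carrier (square_matrices R n)"
    using TE(1) by (auto simp: square_matrices_simps PiE_iff)
  show "\<one>\<^bsub>square_matrices (R\<lparr>carrier := T\<rparr>) n\<^esub> = \<one>\<^bsub>square_matrices R n\<^esub>"
    by (simp add: square_matrices_simps cong: if_cong)
  assume "M \<in> carrier (square_matrices (R\<lparr>carrier := T\<rparr>) n)" "N \<in> carrier (square_matrices (R\<lparr>carrier := T\<rparr>) n)"
  then have "M (i, j) \<in> T" "N (i, j) \<in> T" if "i < n" "j < n" for i j
    using that by (auto simp: square_matrices_simps PiE_mem)
  then show "M \<otimes>\<^bsub>square_matrices (R\<lparr>carrier := T\<rparr>) n\<^esub> N = M \<otimes>\<^bsub>square_matrices R n\<^esub> N"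
    unfolding square_matrices_simps
    by (intro restrict_ext) (auto intro!: subring_finsum(2)[OF T] TE(6))
qed

lemma (in ring) rationally_closed_imp_division_closed:
  assumes T: "subring T R" and rat: "rationally_closed T R"
  shows "division_closed T R"
  unfolding division_closed_def
proof (intro ballI impI)
  fix x assume xT: "x \<in> T" and xU: "x \<in> Units R"
  note TE = subringE[OF T]
  define mat where "mat y = (\<lambda>(i::nat, k::nat)\<in>{..<1} \<times> {..<1}. y)" for y :: 'a
  have mat_mult: "mat y \<otimes>\<^bsub>square_matrices R 1\<^esub> mat z = mat (y \<otimes> z)"
    if "y \<in> carrier R" "z \<in> carrier R" for y z
    using that by (auto simp: square_matrices_simps mat_def lessThan_Suc fun_eq_iff)
  have mat_one: "\<one>\<^bsub>square_matrices R 1\<^esub> = mat \<one>"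
    by (auto simp: square_matrices_simps mat_def fun_eq_iff)
  have mat_carrier: "mat y \<in> carrier (square_matrices R 1)" if "y \<in> carrier R" for y
    using that by (auto simp: square_matrices_simps mat_def)
  have "mat x \<in> Units (square_matrices R 1)"
  proof -
    have x: "x \<in> carrier R" "inv x \<in> carrier R" "x \<otimes> inv x = \<one>" "inv x \<otimes> x = \<one>" using xU by auto
    show ?thesis unfolding Units_def using x mat_carrier mat_mult mat_one by fastforce
  qed
  moreover have "mat x \<in> carrier (square_matrices (R\<lparr>carrier := T\<rparr>) 1)"
    using xT by (auto simp: square_matrices_simps mat_def)
  ultimately have "mat x \<in> Units (square_matrices (R\<lparr>carrier := T\<rparr>) 1)"
    using rat unfolding rationally_closed_def by blast
  then obtain N where N: "N \<in> carrier (square_matrices (R\<lparr>carrier := T\<rparr>) 1)"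
    "N \<otimes>\<^bsub>square_matrices (R\<lparr>carrier := T\<rparr>) 1\<^esub> mat x = \<one>\<^bsub>square_matrices (R\<lparr>carrier := T\<rparr>) 1\<^esub>"
    "mat x \<otimes>\<^bsub>square_matrices (R\<lparr>carrier := T\<rparr>) 1\<^esub> N = \<one>\<^bsub>square_matrices (R\<lparr>carrier := T\<rparr>) 1\<^esub>"
    and mx: "mat x \<in> carrier (square_matrices (R\<lparr>carrier := T\<rparr>) 1)"
    unfolding Units_def by blast
  define y where "y = N (0, 0)"
  have y: "y \<in> T" "N = mat y"
    using N(1) unfolding y_def
    by (auto simp: square_matrices_simps mat_def fun_eq_iff PiE_iff extensional_def)
  have yR: "y \<in> carrier R" "x \<in> carrier R" using y TE(1) xT by auto
  have "mat (y \<otimes> x) = mat \<one>" "mat (x \<otimes> y) = mat \<one>"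
    using N(2,3) square_matrices_subring[OF T] N(1) mx y(2) mat_mult mat_one yR by metis+
  from fun_cong[OF this(1), of "(0, 0)"] fun_cong[OF this(2), of "(0, 0)"]
  have "y \<otimes> x = \<one>" "x \<otimes> y = \<one>" by (simp_all add: mat_def)
  then show "x \<in> Units (R\<lparr>carrier := T\<rparr>)" using y(1) xT by (auto simp: Units_def)
qed

text \<open>The heart of the argument.  Let \<open>M\<close> over \<open>T\<close> have the inverse \<open>N\<close> over the whole ring.  The last
  hypothesis is a density condition: it provides \<open>P\<close> over \<open>T\<close>, close enough to \<open>N\<close> for \<open>M (P - N)\<close> to have
  all its entries in \<open>J\<close>, so \<open>M P = I + M (P - N)\<close> lies in \<open>I + M\<^sub>n(K)\<close> with \<open>K = J \<inter> T\<close>.  Division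
  closedness, which speaks of single elements only, makes the quasi-inverse of an element of \<open>K\<close> lie
  in \<open>K\<close>.  Gaussian elimination then yields \<open>Q\<close> over \<open>T\<close> with \<open>M P Q = I\<close>, and \<open>N = P Q\<close> is a
  matrix over \<open>T\<close>.\<close>

lemma (in ring) division_closed_imp_rationally_closed:
  assumes T: "subring T R" and div: "division_closed T R"
    and J: "J \<subseteq> carrier R" "\<zero> \<in> J"
      "\<And>x y. x \<in> J \<Longrightarrow> y \<in> J \<Longrightarrow> x \<ominus> y \<in> J"
      "\<And>x y. x \<in> J \<Longrightarrow> y \<in> J \<Longrightarrow> x \<otimes> y \<in> J"
    and quasi_inverse:
      "\<And>x. x \<in> J \<Longrightarrow> \<exists>y\<in>J. (\<one> \<oplus> x) \<otimes> (\<one> \<oplus> y) = \<one> \<and> (\<one> \<oplus> y) \<otimes> (\<one> \<oplus> x) = \<one>"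
    and approx: "\<And>F b. finite F \<Longrightarrow> F \<subseteq> carrier R \<Longrightarrow> b \<in> carrier R \<Longrightarrow>
      \<exists>t\<in>T. \<forall>a\<in>F. a \<otimes> (t \<ominus> b) \<in> J"
  shows "rationally_closed T R"
  unfolding rationally_closed_def
proof (intro allI ballI impI)
  fix n M
  let ?A = "square_matrices R n" and ?B = "square_matrices (R\<lparr>carrier := T\<rparr>) n"
  assume MT: "M \<in> carrier ?B" and MU: "M \<in> Units ?A"
  note TE = subringE[OF T]
  interpret A: monoid ?A by (rule square_matrices_monoid)
  define N where "N = inv\<^bsub>?A\<^esub> M"
  have N: "N \<in> carrier ?A" "M \<otimes>\<^bsub>?A\<^esub> N = \<one>\<^bsub>?A\<^esub>" "N \<otimes>\<^bsub>?A\<^esub> M = \<one>\<^bsub>?A\<^esub>" "M \<in> carrier ?A"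
    using MU unfolding N_def by auto
  have entry: "M (i, j) \<in> T" "M (i, j) \<in> carrier R" "N (i, j) \<in> carrier R"
    if "i < n" "j < n" for i j
    using that MT N(1,4) by (auto simp: square_matrices_simps PiE_mem)

  define F where "F = M ` ({..<n} \<times> {..<n})"
  have F: "finite F" "F \<subseteq> carrier R" unfolding F_def using entry by auto
  have "\<forall>x. \<exists>t. x \<in> {..<n} \<times> {..<n} \<longrightarrow> t \<in> T \<and> (\<forall>a\<in>F. a \<otimes> (t \<ominus> N x) \<in> J)"
  proof
    fix x
    show "\<exists>t. x \<in> {..<n} \<times> {..<n} \<longrightarrow> t \<in> T \<and> (\<forall>a\<in>F. a \<otimes> (t \<ominus> N x) \<in> J)"
      using approx[OF F, of "N x"] entry(3)[of "fst x" "snd x"] by (cases x) auto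
  qed
  then obtain P0 where P0: "\<And>x. x \<in> {..<n} \<times> {..<n} \<Longrightarrow> P0 x \<in> T"
    "\<And>x a. x \<in> {..<n} \<times> {..<n} \<Longrightarrow> a \<in> F \<Longrightarrow> a \<otimes> (P0 x \<ominus> N x) \<in> J" by metis
  define P where "P = restrict P0 ({..<n} \<times> {..<n})"
  have PT: "P \<in> carrier ?B" unfolding P_def using P0(1) by (auto simp: square_matrices_simps)
  have PJ: "M (i, k) \<otimes> (P (k, j) \<ominus> N (k, j)) \<in> J" if "i < n" "j < n" "k < n" for i j k
    using P0(2)[of "(k, j)" "M (i, k)"] that unfolding P_def F_def by auto
  have PR: "P (i, j) \<in> carrier R" "P (i, j) \<in> T" if "i < n" "j < n" for i j
    using that PT TE(1) by (auto simp: square_matrices_simps PiE_iff)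

  define K where "K = J \<inter> T"
  have K_inverse: "\<exists>y\<in>K. (\<one> \<oplus> x) \<otimes> (\<one> \<oplus> y) = \<one>" if x: "x \<in> K" for x
  proof -
    have xJ: "x \<in> J" "x \<in> T" using x by (auto simp: K_def)
    obtain y where y: "y \<in> J" "(\<one> \<oplus> x) \<otimes> (\<one> \<oplus> y) = \<one>" "(\<one> \<oplus> y) \<otimes> (\<one> \<oplus> x) = \<one>"
      using quasi_inverse[OF xJ(1)] by blast
    have R: "x \<in> carrier R" "y \<in> carrier R" using xJ y J by auto
    have u: "\<one> \<oplus> x \<in> T" using xJ TE(3,7) by blast
    have "\<one> \<oplus> x \<in> Units R" using y R unfolding Units_def by auto
    then have "\<one> \<oplus> x \<in> Units (R\<lparr>carrier := T\<rparr>)" using div u unfolding division_closed_def by blast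
    then obtain w where w: "w \<in> T" "w \<otimes> (\<one> \<oplus> x) = \<one>" unfolding Units_def by auto
    have wR: "w \<in> carrier R" using w(1) TE(1) by blast
    have "w = w \<otimes> ((\<one> \<oplus> x) \<otimes> (\<one> \<oplus> y))" using y(2) wR by simp
    also have "\<dots> = (w \<otimes> (\<one> \<oplus> x)) \<otimes> (\<one> \<oplus> y)" using wR R by (intro m_assoc[symmetric]) auto
    also have "\<dots> = \<one> \<oplus> y" using w(2) R by simp
    finally have "\<one> \<oplus> y \<in> T" using w(1) by simp
    then have "\<ominus> \<one> \<oplus> (\<one> \<oplus> y) \<in> T" using TE(3,5,7) by blast
    then have "y \<in> T" using R by (simp add: r_neg1)
    with y show ?thesis unfolding K_def by blast
  qed
  have MP: "\<exists>x\<in>K. (M \<otimes>\<^bsub>?A\<^esub> P) (i, j) = (if i = j then \<one> else \<zero>) \<oplus> x" if ij: "i < n" "j < n" for i j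
  proof -
    define x where "x = (\<Oplus>k\<in>{..<n}. M (i, k) \<otimes> (P (k, j) \<ominus> N (k, j)))"
    have addJ: "a \<oplus> b \<in> J" if "a \<in> J" "b \<in> J" for a b
      using J(3)[OF that(1) J(3)[OF J(2) that(2)]] J(1) that by (simp add: minus_eq subset_iff)
    have sumJ: "finsum R f I \<in> J" if "finite I" "\<And>k. k \<in> I \<Longrightarrow> f k \<in> J" for f and I :: "nat set"
      using that
    proof (induction I rule: finite_induct)
      case (insert k I)
      then have "finsum R f (insert k I) = f k \<oplus> finsum R f I"
        using J(1) by (intro finsum_insert) auto
      then show ?case using insert addJ by simp
    qed (use J in auto)
    have xJ: "x \<in> J" unfolding x_def using PJ ij by (intro sumJ) auto
    have xR: "x \<in> carrier R" using xJ J(1) by blast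
    have MNij: "(\<Oplus>k\<in>{..<n}. M (i, k) \<otimes> N (k, j)) = (if i = j then \<one> else \<zero>)"
      using fun_cong[OF N(2), of "(i, j)"] ij by (simp add: square_matrices_simps)
    have MPij: "(M \<otimes>\<^bsub>?A\<^esub> P) (i, j) = (\<Oplus>k\<in>{..<n}. M (i, k) \<otimes> P (k, j))"
      using ij by (simp add: square_matrices_simps)
    also have "\<dots> = (\<Oplus>k\<in>{..<n}. M (i, k) \<otimes> N (k, j) \<oplus> M (i, k) \<otimes> (P (k, j) \<ominus> N (k, j)))"
    proof (intro finsum_cong')
      fix k assume "k \<in> {..<n}"
      then have R: "M (i, k) \<in> carrier R" "N (k, j) \<in> carrier R" "P (k, j) \<in> carrier R"
        using entry PR ij by auto
      have "P (k, j) = N (k, j) \<oplus> (P (k, j) \<ominus> N (k, j))"  using R by (simp add: add_minus_cancel)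
      then show "M (i, k) \<otimes> P (k, j) = M (i, k) \<otimes> N (k, j) \<oplus> M (i, k) \<otimes> (P (k, j) \<ominus> N (k, j))"
        using R by (metis r_distr minus_closed)
    qed (use entry PR ij in auto)
    also have "\<dots> = (\<Oplus>k\<in>{..<n}. M (i, k) \<otimes> N (k, j)) \<oplus> x"
      unfolding x_def using entry PR ij by (intro finsum_addf) auto
    finally have eq: "(M \<otimes>\<^bsub>?A\<^esub> P) (i, j) = (if i = j then \<one> else \<zero>) \<oplus> x" using MNij by simp
    have "(M \<otimes>\<^bsub>?A\<^esub> P) (i, j) \<in> T"
      unfolding MPij using entry PR ij TE(6) by (intro subring_finsum(1)[OF T]) auto
    then have "\<ominus> (if i = j then \<one> else \<zero>) \<oplus> (M \<otimes>\<^bsub>?A\<^esub> P) (i, j) \<in> T"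
      using TE(2,3,5,7) by auto
    then have "x \<in> T" unfolding eq using xR by (auto simp: r_neg1 split: if_splits)
    with xJ eq show ?thesis unfolding K_def by blast
  qed
  have "\<exists>q. (\<forall>j<n. q j \<in> T) \<and>
      (\<forall>i<n. (\<Oplus>j\<in>{..<n}. (M \<otimes>\<^bsub>?A\<^esub> P) (i, j) \<otimes> q j) = (if i = l then \<one> else \<zero>))" for l
    by (rule linear_system_solvable[OF T, where K = K])
      (use J TE K_inverse MP in \<open>auto simp: K_def minus_eq\<close>)
  then obtain Q0 where Q0: "\<And>l j. j < n \<Longrightarrow> Q0 l j \<in> T"
      "\<And>l i. i < n \<Longrightarrow>
        (\<Oplus>j\<in>{..<n}. (M \<otimes>\<^bsub>?A\<^esub> P) (i, j) \<otimes> Q0 l j) = (if i = l then \<one> else \<zero>)" by metis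
  define Q where "Q = (\<lambda>(j, l)\<in>{..<n} \<times> {..<n}. Q0 l j)"
  have QT: "Q \<in> carrier ?B" unfolding Q_def using Q0(1) by (auto simp: square_matrices_simps)
  have carr: "P \<in> carrier ?A" "Q \<in> carrier ?A"
    using PT QT square_matrices_subring(1)[OF T] by blast+
  have MPQ: "(M \<otimes>\<^bsub>?A\<^esub> P) \<otimes>\<^bsub>?A\<^esub> Q = \<one>\<^bsub>?A\<^esub>"
  proof
    fix x
    have "(\<Oplus>j\<in>{..<n}. (M \<otimes>\<^bsub>?A\<^esub> P) (i, j) \<otimes> Q (j, l)) = (if i = l then \<one> else \<zero>)"
      if il: "i < n" "l < n" for i l
    proof -
      have "(M \<otimes>\<^bsub>?A\<^esub> P) (i, j) \<otimes> Q0 l j \<in> carrier R" if "j < n" for j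
      proof -
        have "M \<otimes>\<^bsub>?A\<^esub> P \<in> carrier ?A" using carr N(4) by blast
        then show ?thesis using Q0(1)[OF that, of l] il(1) that TE(1)
          by (auto simp: square_matrices_simps PiE_iff)
      qed
      then have "(\<Oplus>j\<in>{..<n}. (M \<otimes>\<^bsub>?A\<^esub> P) (i, j) \<otimes> Q (j, l)) =
         (\<Oplus>j\<in>{..<n}. (M \<otimes>\<^bsub>?A\<^esub> P) (i, j) \<otimes> Q0 l j)"
        using il by (intro finsum_cong') (auto simp: Q_def)
      then show ?thesis using Q0(2)[OF il(1)] by simp
    qed
    then show "((M \<otimes>\<^bsub>?A\<^esub> P) \<otimes>\<^bsub>?A\<^esub> Q) x = \<one>\<^bsub>?A\<^esub> x"
      unfolding square_matrices_simps(2) square_matrices_simps(3)[of _ _ _ Q]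
      by (cases x) (auto simp: restrict_def)
  qed
  define V where "V = P \<otimes>\<^bsub>?A\<^esub> Q"
  have "N = N \<otimes>\<^bsub>?A\<^esub> (M \<otimes>\<^bsub>?A\<^esub> V)" unfolding V_def using MPQ N carr by (simp add: A.m_assoc)
  also have "\<dots> = V" unfolding V_def using N carr by (simp add: A.m_assoc[symmetric])
  finally have NV: "N = V" .
  have "V \<in> carrier ?B"
    unfolding V_def using PT QT square_matrices_subring(3)[OF T, of P n Q]
      monoid.m_closed[OF ring.square_matrices_monoid[OF subring_is_ring[OF T]], of P n Q] by simp
  then have "V \<otimes>\<^bsub>?B\<^esub> M = \<one>\<^bsub>?B\<^esub>" "M \<otimes>\<^bsub>?B\<^esub> V = \<one>\<^bsub>?B\<^esub>" 
    using N(2,3) NV square_matrices_subring(2,3)[OF T] MT by simp_all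
  with MT \<open>V \<in> carrier ?B\<close> show "M \<in> Units ?B" unfolding Units_def by blast
qed

section \<open>The Novikov-Sikorav ring\<close>

locale novikov = R: ring R + G: group G
  for R :: "('r, 'm) ring_scheme" (structure) and G :: "('g, 'n) monoid_scheme" +
  fixes \<phi> :: "'g \<Rightarrow> real"
  assumes character: "\<phi> \<in> hom G real_group"
begin

abbreviation N where "N \<equiv> novikov_ring R G \<phi>"

definition supported_from :: "('g \<Rightarrow> 'r) \<Rightarrow> real \<Rightarrow> bool" where
  "supported_from a \<alpha> \<longleftrightarrow> (\<forall>g\<in>carrier G. a g \<noteq> \<zero> \<longrightarrow> \<alpha> \<le> \<phi> g)"

lemma phi_mult: "g \<in> carrier G \<Longrightarrow> h \<in> carrier G \<Longrightarrow> \<phi> (g \<otimes>\<^bsub>G\<^esub> h) = \<phi> g + \<phi> h"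
  using character by (auto simp: hom_def real_group_def)

lemma phi_one: "\<phi> \<one>\<^bsub>G\<^esub> = 0"
  using phi_mult[of "\<one>\<^bsub>G\<^esub>" "\<one>\<^bsub>G\<^esub>"] by simp

lemma phi_quotient:
  assumes "g \<in> carrier G" "h \<in> carrier G"
  shows "\<phi> (inv\<^bsub>G\<^esub> h \<otimes>\<^bsub>G\<^esub> g) = \<phi> g - \<phi> h"
proof -
  have "\<phi> h + \<phi> (inv\<^bsub>G\<^esub> h \<otimes>\<^bsub>G\<^esub> g) = \<phi> (h \<otimes>\<^bsub>G\<^esub> (inv\<^bsub>G\<^esub> h \<otimes>\<^bsub>G\<^esub> g))"
    using assms by (simp add: phi_mult)
  also have "h \<otimes>\<^bsub>G\<^esub> (inv\<^bsub>G\<^esub> h \<otimes>\<^bsub>G\<^esub> g) = g" using assms by (simp add: G.m_assoc[symmetric])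
  finally show ?thesis by simp
qed

lemma supported_from_quotient:
  assumes "supported_from a \<alpha>" "g \<in> carrier G" "h \<in> carrier G" "a (inv\<^bsub>G\<^esub> h \<otimes>\<^bsub>G\<^esub> g) \<noteq> \<zero>"
  shows "\<alpha> \<le> \<phi> g - \<phi> h"
  using assms by (auto simp: supported_from_def simp flip: phi_quotient)

lemma novikov_simps:
  "carrier N = {a \<in> carrier G \<rightarrow>\<^sub>E carrier R. \<forall>s. finite {g \<in> carrier G. a g \<noteq> \<zero> \<and> \<phi> g < s}}"
  "\<one>\<^bsub>N\<^esub> = (\<lambda>g\<in>carrier G. if g = \<one>\<^bsub>G\<^esub> then \<one> else \<zero>)"
  "\<zero>\<^bsub>N\<^esub> = (\<lambda>g\<in>carrier G. \<zero>)"
  "a \<oplus>\<^bsub>N\<^esub> b = (\<lambda>g\<in>carrier G. a g \<oplus> b g)"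
  "a \<otimes>\<^bsub>N\<^esub> b = convolution R G a b"
  by (simp_all add: novikov_ring_def formal_sum_ring_def formal_sums_def)

lemma coeff_closed: "a \<in> carrier N \<Longrightarrow> g \<in> carrier G \<Longrightarrow> a g \<in> carrier R"
  by (auto simp: novikov_simps)

lemma finite_below: "a \<in> carrier N \<Longrightarrow> finite {g \<in> carrier G. a g \<noteq> \<zero> \<and> \<phi> g < s}"
  by (auto simp: novikov_simps)

lemma novikov_eqI:
  assumes "a \<in> carrier N" "b \<in> carrier N" "\<And>g. g \<in> carrier G \<Longrightarrow> a g = b g"
  shows "a = b"
  using assms by (auto simp: novikov_simps intro: PiE_ext)

lemma novikovI:
  assumes "\<And>g. g \<in> carrier G \<Longrightarrow> a g \<in> carrier R" "a \<in> extensional (carrier G)"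
    and "\<And>s. \<exists>F. finite F \<and> {g \<in> carrier G. a g \<noteq> \<zero> \<and> \<phi> g < s} \<subseteq> F"
  shows "a \<in> carrier N"
proof -
  have "finite {g \<in> carrier G. a g \<noteq> \<zero> \<and> \<phi> g < s}" for s using assms(3)[of s] finite_subset by blast
  then show ?thesis using assms(1,2) by (auto simp: novikov_simps PiE_def)
qed

lemma ex_support_bound:
  assumes "a \<in> carrier N"
  shows "\<exists>\<alpha>. supported_from a \<alpha>"
proof -
  let ?S = "\<phi> ` {g \<in> carrier G. a g \<noteq> \<zero> \<and> \<phi> g < 0}"
  have "finite (insert 0 ?S)" using finite_below[OF assms] by auto
  then have "\<forall>r\<in>insert 0 ?S. Min (insert 0 ?S) \<le> r" by simp
  then have "supported_from a (Min (insert 0 ?S))"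
    unfolding supported_from_def by (metis (mono_tags, lifting) image_eqI insertCI linorder_not_le
        mem_Collect_eq order.trans order_less_imp_le)
  then show ?thesis by blast
qed

lemma finite_factorisations:
  assumes a: "a \<in> carrier N" and b: "b \<in> carrier N" and g: "g \<in> carrier G"
  shows "finite {h \<in> carrier G. a h \<noteq> \<zero> \<and> b (inv\<^bsub>G\<^esub> h \<otimes>\<^bsub>G\<^esub> g) \<noteq> \<zero>}"
proof -
  obtain \<beta> where \<beta>: "supported_from b \<beta>" using ex_support_bound[OF b] by blast
  have "{h \<in> carrier G. a h \<noteq> \<zero> \<and> b (inv\<^bsub>G\<^esub> h \<otimes>\<^bsub>G\<^esub> g) \<noteq> \<zero>}
      \<subseteq> {h \<in> carrier G. a h \<noteq> \<zero> \<and> \<phi> h < \<phi> g - \<beta> + 1}"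
    using supported_from_quotient[OF \<beta> g] by fastforce
  then show ?thesis using finite_below[OF a] finite_subset by blast
qed

text \<open>The sum that defines a coefficient of a product ranges over a set depending on the factors
  and on the place.  Replacing it by any larger finite set makes sums with different ranges
  comparable, as distributivity and associativity require.\<close>

lemma convolution_eq:
  assumes a: "a \<in> carrier N" and b: "b \<in> carrier N" and g: "g \<in> carrier G"
    and H: "finite H" "H \<subseteq> carrier G"
      "\<And>h. h \<in> carrier G \<Longrightarrow> a h \<noteq> \<zero> \<Longrightarrow> b (inv\<^bsub>G\<^esub> h \<otimes>\<^bsub>G\<^esub> g) \<noteq> \<zero> \<Longrightarrow> h \<in> H"
  shows "convolution R G a b g = (\<Oplus>h\<in>H. a h \<otimes> b (inv\<^bsub>G\<^esub> h \<otimes>\<^bsub>G\<^esub> g))"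
proof -
  have c: "a h \<in> carrier R" "b (inv\<^bsub>G\<^esub> h \<otimes>\<^bsub>G\<^esub> g) \<in> carrier R" if "h \<in> H" for h
    using that H(2) g coeff_closed[OF a] coeff_closed[OF b] by auto
  have "(\<Oplus>h\<in>{h \<in> carrier G. a h \<noteq> \<zero> \<and> b (inv\<^bsub>G\<^esub> h \<otimes>\<^bsub>G\<^esub> g) \<noteq> \<zero>}. a h \<otimes> b (inv\<^bsub>G\<^esub> h \<otimes>\<^bsub>G\<^esub> g))
      = (\<Oplus>h\<in>H. a h \<otimes> b (inv\<^bsub>G\<^esub> h \<otimes>\<^bsub>G\<^esub> g))"
  proof (rule R.add.finprod_mono_neutral_cong_left[OF H(1)])
    fix h assume "h \<in> H - {h \<in> carrier G. a h \<noteq> \<zero> \<and> b (inv\<^bsub>G\<^esub> h \<otimes>\<^bsub>G\<^esub> g) \<noteq> \<zero>}"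
    then have "h \<in> H" "a h = \<zero> \<or> b (inv\<^bsub>G\<^esub> h \<otimes>\<^bsub>G\<^esub> g) = \<zero>" using H(2) by auto
    then show "a h \<otimes> b (inv\<^bsub>G\<^esub> h \<otimes>\<^bsub>G\<^esub> g) = \<zero>" using c by auto
  qed (use H(3) c in auto)
  then show ?thesis using g by (simp add: convolution_def)
qed

lemma convolution_nonzeroE:
  assumes g: "g \<in> carrier G" and nz: "convolution R G a b g \<noteq> \<zero>"
  obtains h where "h \<in> carrier G" "a h \<noteq> \<zero>" "b (inv\<^bsub>G\<^esub> h \<otimes>\<^bsub>G\<^esub> g) \<noteq> \<zero>"
proof -
  have "{h \<in> carrier G. a h \<noteq> \<zero> \<and> b (inv\<^bsub>G\<^esub> h \<otimes>\<^bsub>G\<^esub> g) \<noteq> \<zero>} \<noteq> {}"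
  proof
    assume "{h \<in> carrier G. a h \<noteq> \<zero> \<and> b (inv\<^bsub>G\<^esub> h \<otimes>\<^bsub>G\<^esub> g) \<noteq> \<zero>} = {}"
    then have "convolution R G a b g = \<zero>" using g by (simp add: convolution_def del: Collect_empty_eq)
    with nz show False ..
  qed
  then show ?thesis using that by blast
qed

lemma convolution_coeff_closed:
  assumes a: "a \<in> carrier N" and b: "b \<in> carrier N" and g: "g \<in> carrier G"
  shows "convolution R G a b g \<in> carrier R"
  using g coeff_closed[OF a] coeff_closed[OF b] by (auto simp: convolution_def intro!: R.finsum_closed)

lemma convolution_closed:
  assumes a: "a \<in> carrier N" and b: "b \<in> carrier N"
  shows "convolution R G a b \<in> carrier N"
proof (rule novikovI)
  fix s
  obtain \<alpha> where \<alpha>: "supported_from a \<alpha>" using ex_support_bound[OF a] by blast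
  obtain \<beta> where \<beta>: "supported_from b \<beta>" using ex_support_bound[OF b] by blast
  let ?U = "{u \<in> carrier G. a u \<noteq> \<zero> \<and> \<phi> u < s - \<beta>}"
  let ?V = "{v \<in> carrier G. b v \<noteq> \<zero> \<and> \<phi> v < s - \<alpha>}"
  let ?F = "(\<lambda>(u, v). u \<otimes>\<^bsub>G\<^esub> v) ` (?U \<times> ?V)"
  have "{g \<in> carrier G. convolution R G a b g \<noteq> \<zero> \<and> \<phi> g < s} \<subseteq> ?F"
  proof
    fix g assume "g \<in> {g \<in> carrier G. convolution R G a b g \<noteq> \<zero> \<and> \<phi> g < s}"
    then have g: "g \<in> carrier G" "convolution R G a b g \<noteq> \<zero>" "\<phi> g < s" by auto
    obtain h where h: "h \<in> carrier G" "a h \<noteq> \<zero>" "b (inv\<^bsub>G\<^esub> h \<otimes>\<^bsub>G\<^esub> g) \<noteq> \<zero>"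
      using convolution_nonzeroE[OF g(1,2)] .
    have v: "inv\<^bsub>G\<^esub> h \<otimes>\<^bsub>G\<^esub> g \<in> carrier G" using g h by simp
    have "\<alpha> \<le> \<phi> h" "\<beta> \<le> \<phi> g - \<phi> h"
      using \<alpha> supported_from_quotient[OF \<beta>] g h by (auto simp: supported_from_def)
    then have "(h, inv\<^bsub>G\<^esub> h \<otimes>\<^bsub>G\<^esub> g) \<in> ?U \<times> ?V" using g h v by (simp add: phi_quotient)
    moreover have "g = (\<lambda>(u, v). u \<otimes>\<^bsub>G\<^esub> v) (h, inv\<^bsub>G\<^esub> h \<otimes>\<^bsub>G\<^esub> g)"
      using g h by (simp add: G.m_assoc[symmetric])
    ultimately show "g \<in> ?F" by (rule rev_image_eqI)
  qed
  moreover have "finite ?F" using finite_below[OF a] finite_below[OF b] by blast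
  ultimately show "\<exists>F. finite F \<and> {g \<in> carrier G. convolution R G a b g \<noteq> \<zero> \<and> \<phi> g < s} \<subseteq> F" by blast
qed (use convolution_coeff_closed[OF a b] in \<open>auto simp: convolution_def\<close>)

lemma convolution_supported_from:
  assumes "supported_from a \<alpha>" "supported_from b \<beta>"
  shows "supported_from (convolution R G a b) (\<alpha> + \<beta>)"
  unfolding supported_from_def
proof (intro ballI impI)
  fix g assume g: "g \<in> carrier G" "convolution R G a b g \<noteq> \<zero>"
  obtain h where h: "h \<in> carrier G" "a h \<noteq> \<zero>" "b (inv\<^bsub>G\<^esub> h \<otimes>\<^bsub>G\<^esub> g) \<noteq> \<zero>"
    using convolution_nonzeroE[OF g] .
  then have "\<alpha> \<le> \<phi> h" "\<beta> \<le> \<phi> g - \<phi> h"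
    using assms(1) supported_from_quotient[OF assms(2)] g by (auto simp: supported_from_def)
  then show "\<alpha> + \<beta> \<le> \<phi> g" by simp
qed

text \<open>Both sides at \<open>g\<close> are the sum of \<open>a(u) b(v) c(w)\<close> over the factorisations \<open>g = u v w\<close>, and
  only finitely many of these contribute: with lower bounds \<open>\<beta>\<close>, \<open>\<gamma>\<close> for \<open>\<phi>\<close> on the supports of
  \<open>b\<close> and \<open>c\<close>, the element \<open>u\<close> satisfies \<open>\<phi> u \<le> \<phi> g - \<beta> - \<gamma>\<close>, and for each \<open>u\<close> there are
  finitely many choices of \<open>h = u v\<close>.  The proof writes both sides as a double sum over \<open>u\<close> and \<open>h\<close>
  in the same finite sets.\<close>

lemma convolution_assoc:
  assumes a: "a \<in> carrier N" and b: "b \<in> carrier N" and c: "c \<in> carrier N"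
  shows "convolution R G (convolution R G a b) c = convolution R G a (convolution R G b c)"
proof (rule novikov_eqI)
  fix g assume g: "g \<in> carrier G"
  note cl = convolution_closed
  obtain \<beta> where \<beta>: "supported_from b \<beta>" using ex_support_bound[OF b] by blast
  obtain \<gamma> where \<gamma>: "supported_from c \<gamma>" using ex_support_bound[OF c] by blast
  \<comment> \<open>The summand \<open>1\<close> turns the weak bound on \<open>\<phi> u\<close> into the strict one for which finiteness is known.\<close>
  define U where "U = {u \<in> carrier G. a u \<noteq> \<zero> \<and> \<phi> u < \<phi> g - \<beta> - \<gamma> + 1}"
  define W where "W u = {h \<in> carrier G. b (inv\<^bsub>G\<^esub> u \<otimes>\<^bsub>G\<^esub> h) \<noteq> \<zero> \<and> c (inv\<^bsub>G\<^esub> h \<otimes>\<^bsub>G\<^esub> g) \<noteq> \<zero>}" for u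
  define H where "H = (\<Union>u\<in>U. W u)"
  have U: "finite U" "U \<subseteq> carrier G" unfolding U_def using finite_below[OF a] by auto
  have quot: "inv\<^bsub>G\<^esub> (inv\<^bsub>G\<^esub> u \<otimes>\<^bsub>G\<^esub> h) \<otimes>\<^bsub>G\<^esub> (inv\<^bsub>G\<^esub> u \<otimes>\<^bsub>G\<^esub> g) = inv\<^bsub>G\<^esub> h \<otimes>\<^bsub>G\<^esub> g"
    if "u \<in> carrier G" "h \<in> carrier G" for u h
  proof -
    have "inv\<^bsub>G\<^esub> (inv\<^bsub>G\<^esub> u \<otimes>\<^bsub>G\<^esub> h) \<otimes>\<^bsub>G\<^esub> (inv\<^bsub>G\<^esub> u \<otimes>\<^bsub>G\<^esub> g) = inv\<^bsub>G\<^esub> h \<otimes>\<^bsub>G\<^esub> (u \<otimes>\<^bsub>G\<^esub> (inv\<^bsub>G\<^esub> u \<otimes>\<^bsub>G\<^esub> g))"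
      using that g by (simp add: G.inv_mult_group G.m_assoc)
    also have "u \<otimes>\<^bsub>G\<^esub> (inv\<^bsub>G\<^esub> u \<otimes>\<^bsub>G\<^esub> g) = g" using that g by (simp add: G.m_assoc[symmetric])
    finally show ?thesis .
  qed
  have inU: "u \<in> U" if "u \<in> carrier G" "h \<in> carrier G" "a u \<noteq> \<zero>"
    "b (inv\<^bsub>G\<^esub> u \<otimes>\<^bsub>G\<^esub> h) \<noteq> \<zero>" "c (inv\<^bsub>G\<^esub> h \<otimes>\<^bsub>G\<^esub> g) \<noteq> \<zero>" for u h
  proof -
    have "\<beta> \<le> \<phi> h - \<phi> u" "\<gamma> \<le> \<phi> g - \<phi> h"
      using supported_from_quotient[OF \<beta>] supported_from_quotient[OF \<gamma>] that g by auto
    then show ?thesis using that unfolding U_def by auto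
  qed
  have shift: "u \<otimes>\<^bsub>G\<^esub> v \<in> carrier G \<and> inv\<^bsub>G\<^esub> u \<otimes>\<^bsub>G\<^esub> (u \<otimes>\<^bsub>G\<^esub> v) = v
      \<and> inv\<^bsub>G\<^esub> (u \<otimes>\<^bsub>G\<^esub> v) \<otimes>\<^bsub>G\<^esub> g = inv\<^bsub>G\<^esub> v \<otimes>\<^bsub>G\<^esub> (inv\<^bsub>G\<^esub> u \<otimes>\<^bsub>G\<^esub> g)"
    if "u \<in> carrier G" "v \<in> carrier G" for u v
    using that g by (simp add: G.inv_mult_group G.m_assoc) (simp add: G.m_assoc[symmetric])
  have W: "finite (W u)" if u: "u \<in> carrier G" for u
  proof -
    have "W u \<subseteq> (\<lambda>v. u \<otimes>\<^bsub>G\<^esub> v) ` {v \<in> carrier G. b v \<noteq> \<zero> \<and> c (inv\<^bsub>G\<^esub> v \<otimes>\<^bsub>G\<^esub> (inv\<^bsub>G\<^esub> u \<otimes>\<^bsub>G\<^esub> g)) \<noteq> \<zero>}"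
    proof
      fix h assume "h \<in> W u"
      then have h: "h \<in> carrier G" "b (inv\<^bsub>G\<^esub> u \<otimes>\<^bsub>G\<^esub> h) \<noteq> \<zero>" "c (inv\<^bsub>G\<^esub> h \<otimes>\<^bsub>G\<^esub> g) \<noteq> \<zero>"
        by (auto simp: W_def)
      then show "h \<in> (\<lambda>v. u \<otimes>\<^bsub>G\<^esub> v) ` {v \<in> carrier G. b v \<noteq> \<zero> \<and> c (inv\<^bsub>G\<^esub> v \<otimes>\<^bsub>G\<^esub> (inv\<^bsub>G\<^esub> u \<otimes>\<^bsub>G\<^esub> g)) \<noteq> \<zero>}"
        using u g by (intro image_eqI[of _ _ "inv\<^bsub>G\<^esub> u \<otimes>\<^bsub>G\<^esub> h"]) (auto simp: quot, simp add: G.m_assoc[symmetric])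
    qed
    then show ?thesis using finite_factorisations[OF b c, of "inv\<^bsub>G\<^esub> u \<otimes>\<^bsub>G\<^esub> g"] u g
      by (meson G.inv_closed G.m_closed finite_imageI finite_subset)
  qed
  have H: "finite H" "H \<subseteq> carrier G" unfolding H_def using U W by (auto simp: W_def)
  have car: "a u \<in> carrier R" "b (inv\<^bsub>G\<^esub> u \<otimes>\<^bsub>G\<^esub> h) \<in> carrier R" "c (inv\<^bsub>G\<^esub> h \<otimes>\<^bsub>G\<^esub> g) \<in> carrier R"
    if "u \<in> U" "h \<in> H" for u h
    using that U H g coeff_closed[OF a] coeff_closed[OF b] coeff_closed[OF c] by (auto simp: subset_iff)

  have "convolution R G (convolution R G a b) c g
      = (\<Oplus>h\<in>H. convolution R G a b h \<otimes> c (inv\<^bsub>G\<^esub> h \<otimes>\<^bsub>G\<^esub> g))"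
  proof (rule convolution_eq[OF cl[OF a b] c g H])
    fix h assume h: "h \<in> carrier G" "convolution R G a b h \<noteq> \<zero>" "c (inv\<^bsub>G\<^esub> h \<otimes>\<^bsub>G\<^esub> g) \<noteq> \<zero>"
    obtain u where "u \<in> carrier G" "a u \<noteq> \<zero>" "b (inv\<^bsub>G\<^esub> u \<otimes>\<^bsub>G\<^esub> h) \<noteq> \<zero>"
      using convolution_nonzeroE[OF h(1,2)] .
    with inU h show "h \<in> H" unfolding H_def W_def by blast
  qed
  also have "\<dots> = (\<Oplus>h\<in>H. \<Oplus>u\<in>U. a u \<otimes> b (inv\<^bsub>G\<^esub> u \<otimes>\<^bsub>G\<^esub> h) \<otimes> c (inv\<^bsub>G\<^esub> h \<otimes>\<^bsub>G\<^esub> g))"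
  proof (rule R.finsum_cong')
    fix h assume hH: "h \<in> H"
    then have h: "h \<in> carrier G" using H by blast
    show "convolution R G a b h \<otimes> c (inv\<^bsub>G\<^esub> h \<otimes>\<^bsub>G\<^esub> g) =
      (\<Oplus>u\<in>U. a u \<otimes> b (inv\<^bsub>G\<^esub> u \<otimes>\<^bsub>G\<^esub> h) \<otimes> c (inv\<^bsub>G\<^esub> h \<otimes>\<^bsub>G\<^esub> g))"
    \<comment> \<open>The set \<open>U\<close> contains the factors \<open>u\<close> contributing to the coefficient at \<open>h\<close> only if \<open>c\<close> does not
      vanish on the complementary factor; otherwise both sides are zero.\<close>
    proof (cases "c (inv\<^bsub>G\<^esub> h \<otimes>\<^bsub>G\<^esub> g) = \<zero>")
      case True
      have "(\<Oplus>u\<in>U. a u \<otimes> b (inv\<^bsub>G\<^esub> u \<otimes>\<^bsub>G\<^esub> h) \<otimes> c (inv\<^bsub>G\<^esub> h \<otimes>\<^bsub>G\<^esub> g)) = (\<Oplus>u\<in>U. \<zero>)"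
        using True car hH by (intro R.finsum_cong') auto
      then show ?thesis using True convolution_coeff_closed[OF a b h] by simp
    next
      case False
      have "convolution R G a b h = (\<Oplus>u\<in>U. a u \<otimes> b (inv\<^bsub>G\<^esub> u \<otimes>\<^bsub>G\<^esub> h))"
        by (rule convolution_eq[OF a b h U]) (use inU h False in blast)
      moreover have "c (inv\<^bsub>G\<^esub> h \<otimes>\<^bsub>G\<^esub> g) \<in> carrier R" using g h coeff_closed[OF c] by simp
      ultimately show ?thesis using U(1) car hH by (simp, intro R.finsum_ldistr) auto
    qed
  qed (use car in \<open>auto intro!: R.finsum_closed\<close>)
  also have "\<dots> = (\<Oplus>u\<in>U. \<Oplus>h\<in>H. a u \<otimes> b (inv\<^bsub>G\<^esub> u \<otimes>\<^bsub>G\<^esub> h) \<otimes> c (inv\<^bsub>G\<^esub> h \<otimes>\<^bsub>G\<^esub> g))"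
    using U H car by (intro R.finsum_swap) auto
  also have "\<dots> = (\<Oplus>u\<in>U. a u \<otimes> convolution R G b c (inv\<^bsub>G\<^esub> u \<otimes>\<^bsub>G\<^esub> g))"
  proof (rule R.finsum_cong')
    fix u assume uU: "u \<in> U"
    then have u: "u \<in> carrier G" using U by blast
    let ?f = "\<lambda>v. b v \<otimes> c (inv\<^bsub>G\<^esub> v \<otimes>\<^bsub>G\<^esub> (inv\<^bsub>G\<^esub> u \<otimes>\<^bsub>G\<^esub> g))" and ?t = "\<lambda>h. inv\<^bsub>G\<^esub> u \<otimes>\<^bsub>G\<^esub> h"
    have f: "?f (?t h) = b (inv\<^bsub>G\<^esub> u \<otimes>\<^bsub>G\<^esub> h) \<otimes> c (inv\<^bsub>G\<^esub> h \<otimes>\<^bsub>G\<^esub> g)" if "h \<in> H" for h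
      using quot[of u h] u that H(2) by auto
    have "convolution R G b c (inv\<^bsub>G\<^esub> u \<otimes>\<^bsub>G\<^esub> g) = (\<Oplus>v\<in>?t ` H. ?f v)"
    proof (rule convolution_eq[OF b c])
      fix v assume v: "v \<in> carrier G" "b v \<noteq> \<zero>" "c (inv\<^bsub>G\<^esub> v \<otimes>\<^bsub>G\<^esub> (inv\<^bsub>G\<^esub> u \<otimes>\<^bsub>G\<^esub> g)) \<noteq> \<zero>"
      then have "u \<otimes>\<^bsub>G\<^esub> v \<in> H" using v shift[OF u v(1)] uU
        unfolding H_def W_def by (intro UN_I[of u]) auto
      then show "v \<in> ?t ` H" using shift[OF u v(1)] by (intro image_eqI[of _ _ "u \<otimes>\<^bsub>G\<^esub> v"]) auto
    qed (use H u g in auto)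
    also have "\<dots> = (\<Oplus>h\<in>H. ?f (?t h))"
    proof (rule R.finsum_reindex)
      show "inj_on ?t H" using u H(2) by (intro inj_onI) (auto simp: subset_iff)
    qed (use f car uU in \<open>auto simp: Pi_def\<close>)
    also have "\<dots> = (\<Oplus>h\<in>H. b (inv\<^bsub>G\<^esub> u \<otimes>\<^bsub>G\<^esub> h) \<otimes> c (inv\<^bsub>G\<^esub> h \<otimes>\<^bsub>G\<^esub> g))"
      using f car uU by (intro R.finsum_cong') auto
    finally have "a u \<otimes> convolution R G b c (inv\<^bsub>G\<^esub> u \<otimes>\<^bsub>G\<^esub> g)
       = (\<Oplus>h\<in>H. a u \<otimes> (b (inv\<^bsub>G\<^esub> u \<otimes>\<^bsub>G\<^esub> h) \<otimes> c (inv\<^bsub>G\<^esub> h \<otimes>\<^bsub>G\<^esub> g)))"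
      using H(1) car uU coeff_closed[OF a u] by (simp, intro R.finsum_rdistr) auto
    also have "\<dots> = (\<Oplus>h\<in>H. a u \<otimes> b (inv\<^bsub>G\<^esub> u \<otimes>\<^bsub>G\<^esub> h) \<otimes> c (inv\<^bsub>G\<^esub> h \<otimes>\<^bsub>G\<^esub> g))"
      using car uU by (intro R.finsum_cong') (auto simp: R.m_assoc)
    finally show "(\<Oplus>h\<in>H. a u \<otimes> b (inv\<^bsub>G\<^esub> u \<otimes>\<^bsub>G\<^esub> h) \<otimes> c (inv\<^bsub>G\<^esub> h \<otimes>\<^bsub>G\<^esub> g)) =
       a u \<otimes> convolution R G b c (inv\<^bsub>G\<^esub> u \<otimes>\<^bsub>G\<^esub> g)" ..
  qed (use U g coeff_closed[OF a] convolution_coeff_closed[OF b c] in auto)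
  also have "\<dots> = convolution R G a (convolution R G b c) g"
  proof (rule convolution_eq[OF a cl[OF b c] g U, symmetric])
    fix u assume u: "u \<in> carrier G" "a u \<noteq> \<zero>" "convolution R G b c (inv\<^bsub>G\<^esub> u \<otimes>\<^bsub>G\<^esub> g) \<noteq> \<zero>"
    have "inv\<^bsub>G\<^esub> u \<otimes>\<^bsub>G\<^esub> g \<in> carrier G" using u g by simp
    then obtain v where "v \<in> carrier G" "b v \<noteq> \<zero>" "c (inv\<^bsub>G\<^esub> v \<otimes>\<^bsub>G\<^esub> (inv\<^bsub>G\<^esub> u \<otimes>\<^bsub>G\<^esub> g)) \<noteq> \<zero>"
      using convolution_nonzeroE u(3) by blast
    then show "u \<in> U" using inU[of u "u \<otimes>\<^bsub>G\<^esub> v"] shift[of u v] u by auto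
  qed
  finally show "convolution R G (convolution R G a b) c g = convolution R G a (convolution R G b c) g" .
qed (use assms convolution_closed in auto)

lemma novikov_one_closed: "\<one>\<^bsub>N\<^esub> \<in> carrier N"
proof (rule novikovI)
  fix s
  show "\<exists>F. finite F \<and> {g \<in> carrier G. \<one>\<^bsub>N\<^esub> g \<noteq> \<zero> \<and> \<phi> g < s} \<subseteq> F"
    by (intro exI[of _ "{\<one>\<^bsub>G\<^esub>}"]) (auto simp: novikov_simps)
qed (auto simp: novikov_simps)

lemma convolution_one:
  assumes a: "a \<in> carrier N"
  shows "convolution R G \<one>\<^bsub>N\<^esub> a = a" and "convolution R G a \<one>\<^bsub>N\<^esub> = a"
proof -
  note one = novikov_one_closed
  show "convolution R G \<one>\<^bsub>N\<^esub> a = a"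
  proof (rule novikov_eqI)
    fix g assume g: "g \<in> carrier G"
    have "convolution R G \<one>\<^bsub>N\<^esub> a g = (\<Oplus>h\<in>{\<one>\<^bsub>G\<^esub>}. \<one>\<^bsub>N\<^esub> h \<otimes> a (inv\<^bsub>G\<^esub> h \<otimes>\<^bsub>G\<^esub> g))"
      by (rule convolution_eq[OF one a g]) (auto simp: novikov_simps split: if_splits)
    also have "\<dots> = a g" using g coeff_closed[OF a g] by (simp add: novikov_simps)
    finally show "convolution R G \<one>\<^bsub>N\<^esub> a g = a g" .
  qed (use a one convolution_closed in auto)
  show "convolution R G a \<one>\<^bsub>N\<^esub> = a"
  proof (rule novikov_eqI)
    fix g assume g: "g \<in> carrier G"
    have "convolution R G a \<one>\<^bsub>N\<^esub> g = (\<Oplus>h\<in>{g}. a h \<otimes> \<one>\<^bsub>N\<^esub> (inv\<^bsub>G\<^esub> h \<otimes>\<^bsub>G\<^esub> g))"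
    proof (rule convolution_eq[OF a one g])
      fix h assume h: "h \<in> carrier G" "\<one>\<^bsub>N\<^esub> (inv\<^bsub>G\<^esub> h \<otimes>\<^bsub>G\<^esub> g) \<noteq> \<zero>"
      then have "inv\<^bsub>G\<^esub> h \<otimes>\<^bsub>G\<^esub> g = \<one>\<^bsub>G\<^esub>" using g by (auto simp: novikov_simps split: if_splits)
      then have "h = g" using h g by (metis G.inv_closed G.inv_equality G.inv_inv)
      then show "h \<in> {g}" by simp
    qed (use g in auto)
    also have "\<dots> = a g" using g coeff_closed[OF a g] by (simp add: novikov_simps)
    finally show "convolution R G a \<one>\<^bsub>N\<^esub> g = a g" .
  qed (use a one convolution_closed in auto)
qed

lemma novikov_add_closed:
  assumes a: "a \<in> carrier N" and b: "b \<in> carrier N"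
  shows "a \<oplus>\<^bsub>N\<^esub> b \<in> carrier N"
proof (rule novikovI)
  fix s
  show "\<exists>F. finite F \<and> {g \<in> carrier G. (a \<oplus>\<^bsub>N\<^esub> b) g \<noteq> \<zero> \<and> \<phi> g < s} \<subseteq> F"
    using finite_below[OF a, of s] finite_below[OF b, of s]
    by (intro exI[of _ "{g \<in> carrier G. a g \<noteq> \<zero> \<and> \<phi> g < s} \<union> {g \<in> carrier G. b g \<noteq> \<zero> \<and> \<phi> g < s}"])
      (auto simp: novikov_simps)
qed (use coeff_closed[OF a] coeff_closed[OF b] in \<open>auto simp: novikov_simps\<close>)

lemma convolution_distrib:
  assumes a: "a \<in> carrier N" and b: "b \<in> carrier N" and c: "c \<in> carrier N"
  shows "convolution R G (a \<oplus>\<^bsub>N\<^esub> b) c = convolution R G a c \<oplus>\<^bsub>N\<^esub> convolution R G b c"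
    and "convolution R G c (a \<oplus>\<^bsub>N\<^esub> b) = convolution R G c a \<oplus>\<^bsub>N\<^esub> convolution R G c b"
proof -
  note ab = novikov_add_closed[OF a b]
  show "convolution R G (a \<oplus>\<^bsub>N\<^esub> b) c = convolution R G a c \<oplus>\<^bsub>N\<^esub> convolution R G b c"
  proof (rule novikov_eqI)
    fix g assume g: "g \<in> carrier G"
    define H where "H = {h \<in> carrier G. a h \<noteq> \<zero> \<and> c (inv\<^bsub>G\<^esub> h \<otimes>\<^bsub>G\<^esub> g) \<noteq> \<zero>}
      \<union> {h \<in> carrier G. b h \<noteq> \<zero> \<and> c (inv\<^bsub>G\<^esub> h \<otimes>\<^bsub>G\<^esub> g) \<noteq> \<zero>}"
    have H: "finite H" "H \<subseteq> carrier G"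
      unfolding H_def using finite_factorisations[OF a c g] finite_factorisations[OF b c g] by auto
    have car: "a h \<in> carrier R" "b h \<in> carrier R" "c (inv\<^bsub>G\<^esub> h \<otimes>\<^bsub>G\<^esub> g) \<in> carrier R" if "h \<in> H" for h
      using that H g coeff_closed[OF a] coeff_closed[OF b] coeff_closed[OF c] by auto
    have "convolution R G (a \<oplus>\<^bsub>N\<^esub> b) c g = (\<Oplus>h\<in>H. (a \<oplus>\<^bsub>N\<^esub> b) h \<otimes> c (inv\<^bsub>G\<^esub> h \<otimes>\<^bsub>G\<^esub> g))"
      by (rule convolution_eq[OF ab c g H]) (auto simp: H_def novikov_simps)
    also have "\<dots> = (\<Oplus>h\<in>H. a h \<otimes> c (inv\<^bsub>G\<^esub> h \<otimes>\<^bsub>G\<^esub> g) \<oplus> b h \<otimes> c (inv\<^bsub>G\<^esub> h \<otimes>\<^bsub>G\<^esub> g))"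
      using H(2) car by (intro R.finsum_cong') (auto simp: novikov_simps R.l_distr subset_iff)
    also have "\<dots> = (\<Oplus>h\<in>H. a h \<otimes> c (inv\<^bsub>G\<^esub> h \<otimes>\<^bsub>G\<^esub> g)) \<oplus> (\<Oplus>h\<in>H. b h \<otimes> c (inv\<^bsub>G\<^esub> h \<otimes>\<^bsub>G\<^esub> g))"
      using car by (intro R.finsum_addf) auto
    also have "(\<Oplus>h\<in>H. a h \<otimes> c (inv\<^bsub>G\<^esub> h \<otimes>\<^bsub>G\<^esub> g)) = convolution R G a c g"
      by (rule convolution_eq[OF a c g H, symmetric]) (auto simp: H_def)
    also have "(\<Oplus>h\<in>H. b h \<otimes> c (inv\<^bsub>G\<^esub> h \<otimes>\<^bsub>G\<^esub> g)) = convolution R G b c g"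
      by (rule convolution_eq[OF b c g H, symmetric]) (auto simp: H_def)
    finally show "convolution R G (a \<oplus>\<^bsub>N\<^esub> b) c g = (convolution R G a c \<oplus>\<^bsub>N\<^esub> convolution R G b c) g"
      using g by (simp add: novikov_simps(4)[of "convolution R G a c"])
  qed (use a b c ab convolution_closed novikov_add_closed in auto)
  show "convolution R G c (a \<oplus>\<^bsub>N\<^esub> b) = convolution R G c a \<oplus>\<^bsub>N\<^esub> convolution R G c b"
  proof (rule novikov_eqI)
    fix g assume g: "g \<in> carrier G"
    define H where "H = {h \<in> carrier G. c h \<noteq> \<zero> \<and> a (inv\<^bsub>G\<^esub> h \<otimes>\<^bsub>G\<^esub> g) \<noteq> \<zero>}
      \<union> {h \<in> carrier G. c h \<noteq> \<zero> \<and> b (inv\<^bsub>G\<^esub> h \<otimes>\<^bsub>G\<^esub> g) \<noteq> \<zero>}"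
    have H: "finite H" "H \<subseteq> carrier G"
      unfolding H_def using finite_factorisations[OF c a g] finite_factorisations[OF c b g] by auto
    have car: "c h \<in> carrier R" "a (inv\<^bsub>G\<^esub> h \<otimes>\<^bsub>G\<^esub> g) \<in> carrier R" "b (inv\<^bsub>G\<^esub> h \<otimes>\<^bsub>G\<^esub> g) \<in> carrier R"
      if "h \<in> H" for h
      using that H g coeff_closed[OF a] coeff_closed[OF b] coeff_closed[OF c] by auto
    have "convolution R G c (a \<oplus>\<^bsub>N\<^esub> b) g = (\<Oplus>h\<in>H. c h \<otimes> (a \<oplus>\<^bsub>N\<^esub> b) (inv\<^bsub>G\<^esub> h \<otimes>\<^bsub>G\<^esub> g))"
      by (rule convolution_eq[OF c ab g H]) (use g in \<open>auto simp: H_def novikov_simps\<close>)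
    also have "\<dots> = (\<Oplus>h\<in>H. c h \<otimes> a (inv\<^bsub>G\<^esub> h \<otimes>\<^bsub>G\<^esub> g) \<oplus> c h \<otimes> b (inv\<^bsub>G\<^esub> h \<otimes>\<^bsub>G\<^esub> g))"
      using H(2) g car by (intro R.finsum_cong') (auto simp: novikov_simps R.r_distr subset_iff)
    also have "\<dots> = (\<Oplus>h\<in>H. c h \<otimes> a (inv\<^bsub>G\<^esub> h \<otimes>\<^bsub>G\<^esub> g)) \<oplus> (\<Oplus>h\<in>H. c h \<otimes> b (inv\<^bsub>G\<^esub> h \<otimes>\<^bsub>G\<^esub> g))"
      using car by (intro R.finsum_addf) auto
    also have "(\<Oplus>h\<in>H. c h \<otimes> a (inv\<^bsub>G\<^esub> h \<otimes>\<^bsub>G\<^esub> g)) = convolution R G c a g"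
      by (rule convolution_eq[OF c a g H, symmetric]) (auto simp: H_def)
    also have "(\<Oplus>h\<in>H. c h \<otimes> b (inv\<^bsub>G\<^esub> h \<otimes>\<^bsub>G\<^esub> g)) = convolution R G c b g"
      by (rule convolution_eq[OF c b g H, symmetric]) (auto simp: H_def)
    finally show "convolution R G c (a \<oplus>\<^bsub>N\<^esub> b) g = (convolution R G c a \<oplus>\<^bsub>N\<^esub> convolution R G c b) g"
      using g by (simp add: novikov_simps(4)[of "convolution R G c a"])
  qed (use a b c ab convolution_closed novikov_add_closed in auto)
qed

lemma novikov_uminus_closed:
  assumes a: "a \<in> carrier N"
  shows "(\<lambda>g\<in>carrier G. \<ominus> a g) \<in> carrier N"
proof (rule novikovI)
  fix s
  show "\<exists>F. finite F \<and> {g \<in> carrier G. (\<lambda>g\<in>carrier G. \<ominus> a g) g \<noteq> \<zero> \<and> \<phi> g < s} \<subseteq> F"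
    using finite_below[OF a, of s] by (intro exI[of _ "{g \<in> carrier G. a g \<noteq> \<zero> \<and> \<phi> g < s}"]) auto
qed (use coeff_closed[OF a] in auto)

lemma novikov_zero_closed: "\<zero>\<^bsub>N\<^esub> \<in> carrier N"
  by (auto simp: novikov_simps)

lemma novikov_is_ring: "ring N"
proof (rule ringI)
  show "abelian_group N"
  proof (rule abelian_groupI)
    fix a assume a: "a \<in> carrier N"
    show "\<exists>b\<in>carrier N. b \<oplus>\<^bsub>N\<^esub> a = \<zero>\<^bsub>N\<^esub>"
      using coeff_closed[OF a] by (intro bexI[OF _ novikov_uminus_closed[OF a]])
        (auto simp: novikov_simps R.l_neg)
    show "\<zero>\<^bsub>N\<^esub> \<oplus>\<^bsub>N\<^esub> a = a"
      using a coeff_closed[OF a] novikov_zero_closed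
      by (intro novikov_eqI novikov_add_closed) (auto simp: novikov_simps(3,4))
    fix b assume b: "b \<in> carrier N"
    show "a \<oplus>\<^bsub>N\<^esub> b \<in> carrier N" using a b by (rule novikov_add_closed)
    show "a \<oplus>\<^bsub>N\<^esub> b = b \<oplus>\<^bsub>N\<^esub> a"
      using coeff_closed[OF a] coeff_closed[OF b]
      by (auto simp: novikov_simps(4) R.a_comm intro!: restrict_ext)
    fix c assume c: "c \<in> carrier N"
    show "a \<oplus>\<^bsub>N\<^esub> b \<oplus>\<^bsub>N\<^esub> c = a \<oplus>\<^bsub>N\<^esub> (b \<oplus>\<^bsub>N\<^esub> c)"
      using coeff_closed[OF a] coeff_closed[OF b] coeff_closed[OF c]
      by (auto simp: novikov_simps(4) R.a_assoc intro!: restrict_ext)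
  qed (rule novikov_zero_closed)
  show "monoid N"
    by (rule monoidI)
      (auto simp: novikov_simps(5) convolution_closed convolution_assoc convolution_one
        intro: novikov_one_closed)
qed (simp_all add: novikov_simps(5) convolution_distrib)

end

sublocale novikov \<subseteq> N: ring N by (rule novikov_is_ring)

context novikov begin

lemma novikov_minus_coeff:
  assumes a: "a \<in> carrier N" and b: "b \<in> carrier N" and g: "g \<in> carrier G"
  shows "(a \<ominus>\<^bsub>N\<^esub> b) g = a g \<ominus> b g"
proof -
  have "\<ominus>\<^bsub>N\<^esub> b = (\<lambda>g\<in>carrier G. \<ominus> b g)"
    using coeff_closed[OF b] by (intro N.minus_equality b novikov_uminus_closed)
      (auto simp: novikov_simps(3,4) R.l_neg)
  then show ?thesis using g by (simp add: a_minus_def novikov_simps(4))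
qed

section \<open>Elements supported where the character is positive\<close>

definition positive_part :: "('g \<Rightarrow> 'r) set" where
  "positive_part = {a \<in> carrier N. \<forall>g\<in>carrier G. a g \<noteq> \<zero> \<longrightarrow> 0 < \<phi> g}"

text \<open>Positivity of \<open>\<phi>\<close> on the support is automatically uniform, since only finitely many
  elements of the support have value below \<open>1\<close>.  So the powers of \<open>x\<close> move off to infinity even when
  \<open>\<phi>\<close> has dense image.\<close>

lemma positive_part_supported_from:
  assumes x: "x \<in> positive_part"
  obtains \<epsilon> where "0 < \<epsilon>" "supported_from x \<epsilon>"
proof
  let ?S = "\<phi> ` {g \<in> carrier G. x g \<noteq> \<zero> \<and> \<phi> g < 1}"
  have xN: "x \<in> carrier N" and pos: "\<And>g. g \<in> carrier G \<Longrightarrow> x g \<noteq> \<zero> \<Longrightarrow> 0 < \<phi> g"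
    using x by (auto simp: positive_part_def)
  have fin: "finite (insert 1 ?S)" using finite_below[OF xN] by auto
  show "0 < Min (insert 1 ?S)" using fin pos by (subst Min_gr_iff) auto
  show "supported_from x (Min (insert 1 ?S))"
    unfolding supported_from_def
  proof (intro ballI impI)
    fix g assume g: "g \<in> carrier G" "x g \<noteq> \<zero>"
    show "Min (insert 1 ?S) \<le> \<phi> g"
    proof (cases "\<phi> g < 1")
      case True
      then show ?thesis using fin g by (intro Min_le) auto
    next
      case False
      moreover have "Min (insert 1 ?S) \<le> 1" using fin by (intro Min_le) auto
      ultimately show ?thesis by simp
    qed
  qed
qed

lemma supported_from_pow:
  assumes z: "z \<in> carrier N" and "supported_from z \<epsilon>"
  shows "supported_from (z [^]\<^bsub>N\<^esub> k) (real k * \<epsilon>)"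
proof (induction k)
  case 0
  then show ?case by (auto simp: supported_from_def novikov_simps(2) phi_one)
next
  case (Suc k)
  show ?case using convolution_supported_from[OF Suc assms(2)]
    by (simp add: novikov_simps(5) algebra_simps)
qed

text \<open>Multiplication by an element whose support has no negative values is causal: a coefficient
  of the product does not see the coefficients of the other factor at larger values of \<open>\<phi>\<close>.  This
  replaces continuity of the multiplication when passing to the limit of a series.\<close>

lemma convolution_cong_below:
  assumes a: "a \<in> carrier N" and b: "b \<in> carrier N" and c: "c \<in> carrier N" and g: "g \<in> carrier G"
    and supp: "supported_from a 0"
    and eq: "\<And>h. h \<in> carrier G \<Longrightarrow> \<phi> h \<le> \<phi> g \<Longrightarrow> b h = c h"
  shows "convolution R G a b g = convolution R G a c g"
    and "convolution R G b a g = convolution R G c a g"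
proof -
  have "b (inv\<^bsub>G\<^esub> h \<otimes>\<^bsub>G\<^esub> g) = c (inv\<^bsub>G\<^esub> h \<otimes>\<^bsub>G\<^esub> g)" if "h \<in> carrier G" "a h \<noteq> \<zero>" for h
    using that supp g by (intro eq) (auto simp: phi_quotient supported_from_def)
  then show "convolution R G a b g = convolution R G a c g"
    unfolding convolution_def using g coeff_closed[OF a] coeff_closed[OF c]
    by simp (intro R.finsum_cong', auto)
  have "b h = c h" if "h \<in> carrier G" "a (inv\<^bsub>G\<^esub> h \<otimes>\<^bsub>G\<^esub> g) \<noteq> \<zero>" for h
  proof (rule eq)
    have "0 \<le> \<phi> (inv\<^bsub>G\<^esub> h \<otimes>\<^bsub>G\<^esub> g)" using that supp g by (auto simp: supported_from_def)
    then show "\<phi> h \<le> \<phi> g" using that g by (simp add: phi_quotient)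
  qed (use that in auto)
  then show "convolution R G b a g = convolution R G c a g"
    unfolding convolution_def using g coeff_closed[OF a] coeff_closed[OF c]
    by simp (intro R.finsum_cong', auto)
qed

text \<open>The inverse of \<open>1 + x\<close> is the geometric series \<open>e = 1 - x + x\<^sup>2 - \<dots>\<close>.  It converges
  coefficientwise because the support of \<open>x\<^sup>n\<close> lies in \<open>\<phi> \<ge> n \<epsilon>\<close>: the partial sums are eventually
  constant at each group element, and are so simultaneously on every half-space \<open>\<phi> < s\<close>.\<close>

lemma positive_part_quasi_inverse:
  assumes x: "x \<in> positive_part"
  shows "\<exists>y\<in>positive_part. (\<one>\<^bsub>N\<^esub> \<oplus>\<^bsub>N\<^esub> x) \<otimes>\<^bsub>N\<^esub> (\<one>\<^bsub>N\<^esub> \<oplus>\<^bsub>N\<^esub> y) = \<one>\<^bsub>N\<^esub>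
      \<and> (\<one>\<^bsub>N\<^esub> \<oplus>\<^bsub>N\<^esub> y) \<otimes>\<^bsub>N\<^esub> (\<one>\<^bsub>N\<^esub> \<oplus>\<^bsub>N\<^esub> x) = \<one>\<^bsub>N\<^esub>"
proof -
  have xN: "x \<in> carrier N" using x by (simp add: positive_part_def)
  obtain \<epsilon> where \<epsilon>: "0 < \<epsilon>" "supported_from x \<epsilon>" using positive_part_supported_from[OF x] .
  define z where "z = \<ominus>\<^bsub>N\<^esub> x"
  have zN: "z \<in> carrier N" using xN by (simp add: z_def)
  have xz: "\<one>\<^bsub>N\<^esub> \<oplus>\<^bsub>N\<^esub> x = \<one>\<^bsub>N\<^esub> \<ominus>\<^bsub>N\<^esub> z" using xN by (simp add: z_def N.minus_eq)
  have z_coeff: "z g = \<ominus> x g" if "g \<in> carrier G" for g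
  proof -
    have "z = \<zero>\<^bsub>N\<^esub> \<ominus>\<^bsub>N\<^esub> x" using xN by (simp add: z_def N.minus_eq)
    then show ?thesis using that xN coeff_closed[OF xN that]
      by (simp add: novikov_minus_coeff) (simp add: novikov_simps(3) R.minus_eq)
  qed
  have "supported_from z \<epsilon>" using \<epsilon>(2) by (auto simp: supported_from_def z_coeff)
  then have pow: "supported_from (z [^]\<^bsub>N\<^esub> k) (real k * \<epsilon>)" for k
    using zN by (rule supported_from_pow[rotated])
  have pow_zero: "(z [^]\<^bsub>N\<^esub> k) g = \<zero>" if "g \<in> carrier G" "\<phi> g < real k * \<epsilon>" for g k
    using pow[of k] that by (force simp: supported_from_def)
  have powN: "z [^]\<^bsub>N\<^esub> k \<in> carrier N" for k :: nat using zN by simp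

  define S where "S n = (\<Oplus>\<^bsub>N\<^esub>k\<in>{..<n}. z [^]\<^bsub>N\<^esub> k)" for n :: nat
  have SN: "S n \<in> carrier N" for n unfolding S_def using powN by (intro N.finsum_closed) auto
  have S_Suc: "S (Suc n) = S n \<oplus>\<^bsub>N\<^esub> z [^]\<^bsub>N\<^esub> n" for n
    unfolding S_def using powN by (rule N.finsum_lessThan_Suc)
  have S_stable: "S m g = S n g" if "g \<in> carrier G" "n \<le> m" "\<phi> g < real n * \<epsilon>" for m n g
    using that(2)
  proof (induction m rule: dec_induct)
    case (step m)
    have "\<phi> g < real m * \<epsilon>" using that(3) step(1) \<epsilon>(1)
      by (meson less_le_trans mult_right_mono of_nat_mono order_less_imp_le)
    then show ?case using step that(1) pow_zero coeff_closed[OF SN that(1)]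
      by (simp add: S_Suc novikov_simps(4))
  qed simp
  \<comment> \<open>Each coefficient of the series is taken from the first partial sum at which it is final.\<close>
  define e where "e = (\<lambda>g\<in>carrier G. S (LEAST n. \<phi> g < real n * \<epsilon>) g)"
  have e_eq: "e g = S n g" if "g \<in> carrier G" "\<phi> g < real n * \<epsilon>" for g n
  proof -
    let ?P = "\<lambda>n. \<phi> g < real n * \<epsilon>"
    show ?thesis unfolding e_def using that S_stable[OF that(1) Least_le[of ?P n] LeastI[of ?P n]]
      by simp
  qed
  have ex_n: "\<exists>n. s < real n * \<epsilon>" for s
    using ex_less_of_nat_mult[OF \<epsilon>(1)] by blast
  have eN: "e \<in> carrier N"
  proof (rule novikovI)
    fix s
    obtain n where n: "s < real n * \<epsilon>" using ex_n by blast
    have "{g \<in> carrier G. e g \<noteq> \<zero> \<and> \<phi> g < s} \<subseteq> {g \<in> carrier G. S n g \<noteq> \<zero> \<and> \<phi> g < s}"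
      using e_eq[of _ n] n by force
    then show "\<exists>F. finite F \<and> {g \<in> carrier G. e g \<noteq> \<zero> \<and> \<phi> g < s} \<subseteq> F"
      using finite_below[OF SN] by blast
  qed (auto simp: e_def coeff_closed[OF SN])

  let ?u = "\<one>\<^bsub>N\<^esub> \<oplus>\<^bsub>N\<^esub> x"
  have uN: "?u \<in> carrier N" using xN by simp
  have u_supp: "supported_from ?u 0"
    using \<epsilon> unfolding supported_from_def by (auto simp: novikov_simps(2,4) phi_one)
  have inverse: "(?u \<otimes>\<^bsub>N\<^esub> e) g = \<one>\<^bsub>N\<^esub> g \<and> (e \<otimes>\<^bsub>N\<^esub> ?u) g = \<one>\<^bsub>N\<^esub> g" if g: "g \<in> carrier G" for g
  proof -
    obtain n where n: "\<phi> g < real n * \<epsilon>" using ex_n by blast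
    have eq: "e h = S n h" if "h \<in> carrier G" "\<phi> h \<le> \<phi> g" for h using that n by (intro e_eq) auto
    have "(\<one>\<^bsub>N\<^esub> \<ominus>\<^bsub>N\<^esub> z [^]\<^bsub>N\<^esub> n) g = \<one>\<^bsub>N\<^esub> g"
      using g pow_zero[OF g n] powN coeff_closed[OF N.one_closed g]
      by (simp add: novikov_minus_coeff R.minus_eq)
    then show ?thesis
      using convolution_cong_below[OF uN eN SN g u_supp eq] N.geometric_sum[OF zN, of n]
      by (simp add: novikov_simps(5)[symmetric] xz S_def)
  qed
  have ue: "?u \<otimes>\<^bsub>N\<^esub> e = \<one>\<^bsub>N\<^esub>" "e \<otimes>\<^bsub>N\<^esub> ?u = \<one>\<^bsub>N\<^esub>"
    using inverse uN eN by (auto intro!: novikov_eqI)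
  define y where "y = e \<ominus>\<^bsub>N\<^esub> \<one>\<^bsub>N\<^esub>"
  have yN: "y \<in> carrier N" unfolding y_def using eN by simp
  have y: "\<one>\<^bsub>N\<^esub> \<oplus>\<^bsub>N\<^esub> y = e" unfolding y_def using eN by (simp add: N.add_minus_cancel)
  have "y \<in> positive_part"
    unfolding positive_part_def
  proof (intro CollectI conjI ballI impI)
    fix g assume g: "g \<in> carrier G" and nz: "y g \<noteq> \<zero>"
    show "0 < \<phi> g"
    proof (rule ccontr)
      assume "\<not> 0 < \<phi> g"
      then have "e g = S 1 g" using \<epsilon>(1) g by (intro e_eq) auto
      also have "S 1 = \<one>\<^bsub>N\<^esub>" unfolding S_def by (simp add: lessThan_Suc)
      finally have "y g = \<zero>" unfolding y_def using g eN coeff_closed[OF N.one_closed g]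
        by (simp add: novikov_minus_coeff R.minus_eq R.r_neg)
      with nz show False ..
    qed
  qed (rule yN)
  with ue y show ?thesis by auto
qed

text \<open>Truncating \<open>b\<close> leaves a finite sum \<open>t\<close>, and \<open>t - b\<close> is supported arbitrarily high.  If \<open>\<phi> \<ge> \<sigma>\<close>
  on the supports of all elements of \<open>F\<close>, then truncating above \<open>- \<sigma>\<close> is enough.\<close>

lemma group_ring_approximation:
  assumes F: "finite F" "F \<subseteq> carrier N" and b: "b \<in> carrier N"
  shows "\<exists>t\<in>carrier (group_ring R G). t \<in> carrier N \<and> (\<forall>a\<in>F. a \<otimes>\<^bsub>N\<^esub> (t \<ominus>\<^bsub>N\<^esub> b) \<in> positive_part)"
proof -
  obtain \<alpha> where \<alpha>: "\<And>a. a \<in> F \<Longrightarrow> supported_from a (\<alpha> a)"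
    using ex_support_bound F(2) by (metis subsetD)
  define \<sigma> where "\<sigma> = Min (insert 0 (\<alpha> ` F))"
  have \<sigma>: "supported_from a \<sigma>" if "a \<in> F" for a
  proof -
    have "\<sigma> \<le> \<alpha> a" unfolding \<sigma>_def using F(1) that by (intro Min_le) auto
    then show ?thesis using \<alpha>[OF that] unfolding supported_from_def by force
  qed
  define t where "t = (\<lambda>g\<in>carrier G. if \<phi> g \<le> - \<sigma> then b g else \<zero>)"
  have t_supp: "{g \<in> carrier G. t g \<noteq> \<zero>} \<subseteq> {g \<in> carrier G. b g \<noteq> \<zero> \<and> \<phi> g < - \<sigma> + 1}"
    unfolding t_def by auto
  have fin: "finite {g \<in> carrier G. t g \<noteq> \<zero>}"
    using finite_below[OF b] t_supp by (rule finite_subset[rotated])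
  have tR: "t g \<in> carrier R" if "g \<in> carrier G" for g
    using that coeff_closed[OF b that] by (simp add: t_def)
  have tN: "t \<in> carrier N"
    by (rule novikovI) (use fin tR in \<open>auto simp: t_def\<close>)
  have tG: "t \<in> carrier (group_ring R G)"
    using fin tR by (auto simp: group_ring_def formal_sum_ring_def formal_sums_def t_def)
  have "a \<otimes>\<^bsub>N\<^esub> (t \<ominus>\<^bsub>N\<^esub> b) \<in> positive_part" if a: "a \<in> F" for a
    unfolding positive_part_def
  proof (intro CollectI conjI ballI impI)
    show "a \<otimes>\<^bsub>N\<^esub> (t \<ominus>\<^bsub>N\<^esub> b) \<in> carrier N" using a F tN b by auto
    fix g assume g: "g \<in> carrier G" "(a \<otimes>\<^bsub>N\<^esub> (t \<ominus>\<^bsub>N\<^esub> b)) g \<noteq> \<zero>"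
    then obtain h where h: "h \<in> carrier G" "a h \<noteq> \<zero>" "(t \<ominus>\<^bsub>N\<^esub> b) (inv\<^bsub>G\<^esub> h \<otimes>\<^bsub>G\<^esub> g) \<noteq> \<zero>"
      unfolding novikov_simps(5) using convolution_nonzeroE by blast
    let ?k = "inv\<^bsub>G\<^esub> h \<otimes>\<^bsub>G\<^esub> g"
    have k: "?k \<in> carrier G" using g h by simp
    have "\<not> \<phi> ?k \<le> - \<sigma>"
    proof
      assume "\<phi> ?k \<le> - \<sigma>"
      then have "(t \<ominus>\<^bsub>N\<^esub> b) ?k = \<zero>" using k coeff_closed[OF b k]
        by (simp add: novikov_minus_coeff[OF tN b]) (simp add: t_def R.minus_eq R.r_neg)
      with h(3) show False ..
    qed
    moreover have "\<sigma> \<le> \<phi> h" using \<sigma>[OF a] h by (auto simp: supported_from_def)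
    ultimately show "0 < \<phi> g" using g h by (simp add: phi_quotient)
  qed
  with tN tG show ?thesis by blast
qed

section \<open>Equality of the closures\<close>

lemma novikov_rationally_closed_iff:
  assumes T: "subring T N" "carrier (group_ring R G) \<subseteq> T"
  shows "rationally_closed T N \<longleftrightarrow> division_closed T N"
proof
  assume div: "division_closed T N"
  show "rationally_closed T N"
  proof (rule N.division_closed_imp_rationally_closed[OF T(1) div, where J = positive_part])
    show "positive_part \<subseteq> carrier N" by (auto simp: positive_part_def)
    show "\<zero>\<^bsub>N\<^esub> \<in> positive_part" by (simp add: positive_part_def, simp add: novikov_simps(3))
    fix x assume x: "x \<in> positive_part"
    then have xN: "x \<in> carrier N" by (simp add: positive_part_def)
    show "\<exists>y\<in>positive_part. (\<one>\<^bsub>N\<^esub> \<oplus>\<^bsub>N\<^esub> x) \<otimes>\<^bsub>N\<^esub> (\<one>\<^bsub>N\<^esub> \<oplus>\<^bsub>N\<^esub> y) = \<one>\<^bsub>N\<^esub>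
      \<and> (\<one>\<^bsub>N\<^esub> \<oplus>\<^bsub>N\<^esub> y) \<otimes>\<^bsub>N\<^esub> (\<one>\<^bsub>N\<^esub> \<oplus>\<^bsub>N\<^esub> x) = \<one>\<^bsub>N\<^esub>"
      using positive_part_quasi_inverse[OF x] .
    fix y assume y: "y \<in> positive_part"
    then have yN: "y \<in> carrier N" by (simp add: positive_part_def)
    have "x g \<noteq> \<zero> \<or> y g \<noteq> \<zero>" if "g \<in> carrier G" "(x \<ominus>\<^bsub>N\<^esub> y) g \<noteq> \<zero>" for g
      using that xN yN by (auto simp: novikov_minus_coeff R.minus_eq)
    then show "x \<ominus>\<^bsub>N\<^esub> y \<in> positive_part" using x y xN yN by (auto simp: positive_part_def)
    obtain \<epsilon> where \<epsilon>: "0 < \<epsilon>" "supported_from x \<epsilon>" using positive_part_supported_from[OF x] .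
    obtain \<delta> where \<delta>: "0 < \<delta>" "supported_from y \<delta>" using positive_part_supported_from[OF y] .
    have "supported_from (x \<otimes>\<^bsub>N\<^esub> y) (\<epsilon> + \<delta>)"
      using convolution_supported_from[OF \<epsilon>(2) \<delta>(2)] by (simp add: novikov_simps(5))
    then show "x \<otimes>\<^bsub>N\<^esub> y \<in> positive_part"
      using xN yN \<epsilon>(1) \<delta>(1) by (fastforce simp: positive_part_def supported_from_def)
  next
    fix F b assume "finite F" "F \<subseteq> carrier N" "b \<in> carrier N"
    then show "\<exists>t\<in>T. \<forall>a\<in>F. a \<otimes>\<^bsub>N\<^esub> (t \<ominus>\<^bsub>N\<^esub> b) \<in> positive_part"
      using group_ring_approximation T(2) by blast
  qed
qed (rule N.rationally_closed_imp_division_closed[OF T(1)])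

end

theorem proposition3p1:
  fixes R :: "('r, 'm) ring_scheme"
    and G :: "('g, 'n) monoid_scheme"
    and \<phi> :: "'g \<Rightarrow> real"
  assumes "ring R"
    and "group G"
    and "finitely_generated G"
    and "\<phi> \<in> nonzero_characters G"
  shows "division_closure (carrier (group_ring R G)) (novikov_ring R G \<phi>) =
         rational_closure (carrier (group_ring R G)) (novikov_ring R G \<phi>)"
proof -
  interpret novikov R G \<phi>
    using assms by (auto intro!: novikov.intro novikov_axioms.intro simp: nonzero_characters_def)
  show ?thesis
    unfolding division_closure_def rational_closure_def
    using novikov_rationally_closed_iff by (intro arg_cong[of _ _ Inter] Collect_cong) blast
qed

end
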